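(* Let $a\ge2$. Suppose the regularity assumption holds with constant $L>0$, $\mathcal X$ satisfies the $\alpha$-Riemannian scaling inequality for some $\alpha>0$, and $\nu:=\inf_{x\in\mathcal X}\|\operatorname{grad}f(x)\|_x>0$. Set $M_{\rm RSI}:=L/(\alpha\nu)$, $$K_{\rm RSI}:=\max\left\{1,\left\lceil\frac{aM_{\rm RSI}}{2}-a\right\rceil\right\},\qquad \widehat K_{\rm RSI}:=\max\left\{K_{\rm RSI},\left\lceil aM_{\rm RSI}-a\right\rceil\right\},$$ and, for $k\ge2$, $$g_k^{\rm rec}:=\min_{\lfloor k/2\rfloor\le j<k}g_j.$$ If RFW-OL($a$) does not terminate, then, for all sufficiently large $k$, $g_k^{\rm rec}=O(k^{-a})$. More precisely, if $m:=\lfloor k/2\rfloor\ge\widehat K_{\rm RSI}$ and $k\ge\lceil2a\rceil$, then $$g_k^{\rm rec}\le\frac{2h_m}{a\log(3/2)}.$$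
   Context: Setting. $\mathcal M$ is a connected, complete, finite-dimensional Riemannian manifold with distance $d$, tangent spaces $T_x\mathcal M$, inner products $\langle\cdot,\cdot\rangle_x$, norms $\|\cdot\|_x$ and exponential map $\operatorname{Exp}_x$. The set $\mathcal X\subset\mathcal M$ is nonempty and compact, with diameter $D:=\sup_{x,y\in\mathcal X}d(x,y)>0$, and is weakly minimizing-geodesically convex: for all $x,y\in\mathcal X$ there is at least one distance-minimizing geodesic from $x$ to $y$ whose image is contained in $\mathcal X$. For $x\in\mathcal X$ the set of feasible minimizing initial velocities is $$\mathcal V(x):=\{v\in T_x\mathcal M:\ \operatorname{Exp}_x(v)\in\mathcal X,\ \|v\|_x=d(x,\operatorname{Exp}_x(v)),\ \operatorname{Exp}_x(tv)\in\mathcal X\ \text{for all }t\in[0,1]\}.$$ The function $f$ is real-valued and differentiable on an open neighborhood of $\mathcal X$, with Riemannian gradient $\operatorname{grad}f$. Put $f^\star:=\min_{\mathcal X}f$ and $h(x):=f(x)-f^\star$. Regularity assumption (constant $L>0$): for all $x\in\mathcal X$, $v\in\mathcal V(x)$, $t\in[0,1]$, $f(\operatorname{Exp}_x(tv))\le(1-t)f(x)+tf(\operatorname{Exp}_x(v))$ and $f(\operatorname{Exp}_x(tv))\le f(x)+t\langle\operatorname{grad}f(x),v\rangle_x+\frac L2t^2\|v\|_x^2$. $\alpha$-Riemannian scaling inequality (RSI): for all $x\in\mathcal X$, $w\in T_x\mathcal M$ and $v\in\mathcal A(x,w):=\arg\max_{u\in\mathcal V(x)}\langle w,u\rangle_x$,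 one has $\langle w,v\rangle_x\ge\alpha\|w\|_x\|v\|_x^2$. Algorithm RFW-OL($a$). Start from an arbitrary $x_0\in\mathcal X$. For $k=0,1,2,\dots$: choose any $v_k\in\arg\min_{v\in\mathcal V(x_k)}\langle\operatorname{grad}f(x_k),v\rangle_{x_k}$, set $g_k:=-\langle\operatorname{grad}f(x_k),v_k\rangle_{x_k}$ (the Frank–Wolfe gap at $x_k$); if $g_k=0$, terminate and return $x_k$; otherwise set $\eta_k:=a/(k+a)$ and $x_{k+1}:=\operatorname{Exp}_{x_k}(\eta_kv_k)$. Write $h_k:=h(x_k)$. *)

theory Defs
  imports "HOL-Analysis.Analysis" "HOL-Library.Landau_Symbols"
begin

section \<open>Riemannian manifolds\<close>

text \<open>
  The manifold is a whole type \<open>'m\<close>, whose type class topology is the manifold topology, and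
  it is modelled on a Euclidean space \<open>'e\<close> (hence finite-dimensional, without boundary).
  A chart is a pair of a domain and a coordinate map. A tangent vector at \<open>x\<close> is the family of its
  coordinate representations in all the charts around \<open>x\<close>, related by the differentials of the
  transition maps; it is \<open>0\<close> at all other charts, so that tangent vectors at \<open>x\<close> with the same
  coordinates are equal.
\<close>

type_synonym ('m, 'e) chart = "'m set \<times> ('m \<Rightarrow> 'e)"
type_synonym ('m, 'e) tvec = "('m, 'e) chart \<Rightarrow> 'e"

record ('m, 'e) riem =
  charts :: "('m, 'e) chart set"
  rmetric :: "'m \<Rightarrow> ('m, 'e) tvec \<Rightarrow> ('m, 'e) tvec \<Rightarrow> real"

abbreviation dom_ch :: "('m, 'e) chart \<Rightarrow> 'm set" where "dom_ch \<equiv> fst"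
abbreviation crd :: "('m, 'e) chart \<Rightarrow> 'm \<Rightarrow> 'e" where "crd \<equiv> snd"

definition crd_inv :: "('m, 'e) chart \<Rightarrow> 'e \<Rightarrow> 'm" where
  "crd_inv c = inv_into (dom_ch c) (crd c)"

definition transition :: "('m, 'e) chart \<Rightarrow> ('m, 'e) chart \<Rightarrow> 'e \<Rightarrow> 'e" where
  "transition c c' = crd c' \<circ> crd_inv c"

primrec Ck_on ::
  "nat \<Rightarrow> 'a::real_normed_vector set \<Rightarrow> ('a \<Rightarrow> 'b::real_normed_vector) \<Rightarrow> bool" where
  "Ck_on 0 S F = continuous_on S F"
| "Ck_on (Suc n) S F = ((\<forall>p\<in>S. F differentiable (at p)) \<and>
     (\<forall>u. Ck_on n S (\<lambda>p. frechet_derivative F (at p) u)))"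

definition smooth_on :: "'a::real_normed_vector set \<Rightarrow> ('a \<Rightarrow> 'b::real_normed_vector) \<Rightarrow> bool" where
  "smooth_on S F \<longleftrightarrow> (\<forall>n. Ck_on n S F)"

definition smooth_atlas ::
  "('m::topological_space, 'e::euclidean_space) chart set \<Rightarrow> bool" where
  "smooth_atlas A \<longleftrightarrow>
     (\<Union>c\<in>A. dom_ch c) = UNIV \<and>
     (\<forall>c\<in>A. open (dom_ch c) \<and> open (crd c ` dom_ch c) \<and>
        homeomorphism (dom_ch c) (crd c ` dom_ch c) (crd c) (crd_inv c)) \<and>
     (\<forall>c\<in>A. \<forall>c'\<in>A. smooth_on (crd c ` (dom_ch c \<inter> dom_ch c')) (transition c c'))"

definition charts_at :: "('m, 'e) riem \<Rightarrow> 'm \<Rightarrow> ('m, 'e) chart set" where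
  "charts_at M x = {c \<in> charts M. x \<in> dom_ch c}"

definition tangent_space :: "('m, 'e::euclidean_space) riem \<Rightarrow> 'm \<Rightarrow> ('m, 'e) tvec set" where
  "tangent_space M x = {v.
     (\<forall>c. c \<notin> charts_at M x \<longrightarrow> v c = 0) \<and>
     (\<forall>c\<in>charts_at M x. \<forall>c'\<in>charts_at M x.
        v c' = frechet_derivative (transition c c') (at (crd c x)) (v c))}"

definition tscale :: "real \<Rightarrow> ('m, 'e::euclidean_space) tvec \<Rightarrow> ('m, 'e) tvec" where
  "tscale t v = (\<lambda>c. t *\<^sub>R v c)"

definition tadd ::
  "('m, 'e::euclidean_space) tvec \<Rightarrow> ('m, 'e) tvec \<Rightarrow> ('m, 'e) tvec" where
  "tadd u v = (\<lambda>c. u c + v c)"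

definition tzero :: "('m, 'e::euclidean_space) tvec" where
  "tzero = (\<lambda>c. 0)"

text \<open>The tangent vector at \<open>x\<close> with coordinates \<open>u\<close> in the chart \<open>c\<close>.\<close>

definition coord_vec ::
  "('m, 'e::euclidean_space) riem \<Rightarrow> 'm \<Rightarrow> ('m, 'e) chart \<Rightarrow> 'e \<Rightarrow> ('m, 'e) tvec" where
  "coord_vec M x c u = (\<lambda>c'. if c' \<in> charts_at M x
     then frechet_derivative (transition c c') (at (crd c x)) u else 0)"

text \<open>The metric in the chart \<open>c\<close> at the coordinate point \<open>p\<close>; for basis vectors \<open>i\<close>, \<open>j\<close>
  this is the coefficient \<open>g\<^sub>i\<^sub>j(p)\<close>.\<close>

definition metric_coeff ::
  "('m, 'e::euclidean_space) riem \<Rightarrow> ('m, 'e) chart \<Rightarrow> 'e \<Rightarrow> 'e \<Rightarrow> 'e \<Rightarrow> real" where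
  "metric_coeff M c p u w = rmetric M (crd_inv c p)
     (coord_vec M (crd_inv c p) c u) (coord_vec M (crd_inv c p) c w)"

definition is_inner_product_at :: "('m, 'e::euclidean_space) riem \<Rightarrow> 'm \<Rightarrow> bool" where
  "is_inner_product_at M x \<longleftrightarrow>
     (\<forall>u\<in>tangent_space M x. \<forall>v\<in>tangent_space M x.
        rmetric M x u v = rmetric M x v u \<and>
        (\<forall>t. rmetric M x (tscale t u) v = t * rmetric M x u v) \<and>
        (\<forall>w\<in>tangent_space M x. rmetric M x (tadd u w) v = rmetric M x u v + rmetric M x w v)) \<and>
     (\<forall>u\<in>tangent_space M x. u \<noteq> tzero \<longrightarrow> rmetric M x u u > 0)"

definition riemannian_manifold ::
  "('m::{t2_space, second_countable_topology}, 'e::euclidean_space) riem \<Rightarrow> bool" where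
  "riemannian_manifold M \<longleftrightarrow>
     smooth_atlas (charts M) \<and>
     (\<forall>x. is_inner_product_at M x) \<and>
     (\<forall>c\<in>charts M. \<forall>u w. smooth_on (crd c ` dom_ch c) (\<lambda>p. metric_coeff M c p u w))"

definition rnorm :: "('m, 'e) riem \<Rightarrow> 'm \<Rightarrow> ('m, 'e) tvec \<Rightarrow> real" where
  "rnorm M x v = sqrt (rmetric M x v v)"


subsection \<open>Length and distance\<close>

text \<open>Derivatives of a curve defined on an interval \<open>I\<close> are taken within \<open>I\<close>, that is, they
  are one-sided at the end points of \<open>I\<close>.\<close>

definition velocity ::
  "('m, 'e::euclidean_space) riem \<Rightarrow> (real \<Rightarrow> 'm) \<Rightarrow> real set \<Rightarrow> real \<Rightarrow> ('m, 'e) tvec" where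
  "velocity M \<gamma> I t = (\<lambda>c. if c \<in> charts_at M (\<gamma> t)
     then vector_derivative (crd c \<circ> \<gamma>) (at t within I) else 0)"

definition C1_curve_on ::
  "('m::topological_space, 'e::euclidean_space) riem \<Rightarrow> (real \<Rightarrow> 'm) \<Rightarrow> real set \<Rightarrow> bool" where
  "C1_curve_on M \<gamma> I \<longleftrightarrow> continuous_on I \<gamma> \<and>
     (\<forall>c\<in>charts M.
        (\<forall>t\<in>I. \<gamma> t \<in> dom_ch c \<longrightarrow> (crd c \<circ> \<gamma>) differentiable (at t within I)) \<and>
        continuous_on {t\<in>I. \<gamma> t \<in> dom_ch c} (\<lambda>t. vector_derivative (crd c \<circ> \<gamma>) (at t within I)))"

text \<open>The library's \<open>piecewise_C1_differentiable_on\<close> allows the derivative to be unbounded near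
  the exceptional points, and then the speed need not be integrable. Here the curve is \<open>C\<^sup>1\<close> on
  the closed pieces, up to their end points.\<close>

definition piecewise_C1_path ::
  "('m::topological_space, 'e::euclidean_space) riem \<Rightarrow> (real \<Rightarrow> 'm) \<Rightarrow> bool" where
  "piecewise_C1_path M \<gamma> \<longleftrightarrow> continuous_on {0..1} \<gamma> \<and>
     (\<exists>P. finite P \<and> (\<forall>a b. 0 \<le> a \<and> a < b \<and> b \<le> 1 \<and> {a<..<b} \<inter> P = {} \<longrightarrow>
        C1_curve_on M \<gamma> {a..b}))"

definition path_length :: "('m, 'e::euclidean_space) riem \<Rightarrow> (real \<Rightarrow> 'm) \<Rightarrow> real" where
  "path_length M \<gamma> = integral {0..1} (\<lambda>t. rnorm M (\<gamma> t) (velocity M \<gamma> {0..1} t))"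

definition rdist :: "('m::topological_space, 'e::euclidean_space) riem \<Rightarrow> 'm \<Rightarrow> 'm \<Rightarrow> real" where
  "rdist M x y = Inf {path_length M \<gamma> |\<gamma>. piecewise_C1_path M \<gamma> \<and> \<gamma> 0 = x \<and> \<gamma> 1 = y}"


subsection \<open>Geodesics and the exponential map\<close>

text \<open>Christoffel symbols of the first kind,
  \<open>\<Gamma>(u,v;w) = (\<partial>\<^sub>u g(v,w) + \<partial>\<^sub>v g(u,w) - \<partial>\<^sub>w g(u,v)) / 2\<close>.\<close>

definition christoffel1 ::
  "('m, 'e::euclidean_space) riem \<Rightarrow> ('m, 'e) chart \<Rightarrow> 'e \<Rightarrow> 'e \<Rightarrow> 'e \<Rightarrow> 'e \<Rightarrow> real" where
  "christoffel1 M c p u v w =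
     (frechet_derivative (\<lambda>q. metric_coeff M c q v w) (at p) u
      + frechet_derivative (\<lambda>q. metric_coeff M c q u w) (at p) v
      - frechet_derivative (\<lambda>q. metric_coeff M c q u v) (at p) w) / 2"

text \<open>The geodesic equation \<open>z'' + \<Gamma>(z)(z', z') = 0\<close> in every chart, with the index lowered,
  that is, paired by the metric with an arbitrary vector \<open>w\<close>. Geodesics are thus affinely
  parametrized, and constant curves are geodesics.\<close>

definition geodesic_on ::
  "('m::topological_space, 'e::euclidean_space) riem \<Rightarrow> (real \<Rightarrow> 'm) \<Rightarrow> real set \<Rightarrow> bool" where
  "geodesic_on M \<gamma> I \<longleftrightarrow> continuous_on I \<gamma> \<and>
     (\<forall>t\<in>I. \<forall>c\<in>charts_at M (\<gamma> t).
        let z = crd c \<circ> \<gamma>;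
            z' = (\<lambda>s. vector_derivative z (at s within I));
            z'' = (\<lambda>s. vector_derivative z' (at s within I))
        in z differentiable (at t within I) \<and>
           z' differentiable (at t within I) \<and>
           (\<forall>w. metric_coeff M c (z t) (z'' t) w + christoffel1 M c (z t) (z' t) (z' t) w = 0))"

text \<open>Geodesic completeness: every geodesic extends to all times, so that the exponential map
  is defined on the whole of every tangent space.\<close>

definition complete_manifold :: "('m::topological_space, 'e::euclidean_space) riem \<Rightarrow> bool" where
  "complete_manifold M \<longleftrightarrow> (\<forall>x. \<forall>v\<in>tangent_space M x.
     \<exists>\<gamma>. geodesic_on M \<gamma> UNIV \<and> \<gamma> 0 = x \<and> velocity M \<gamma> UNIV 0 = v)"

definition riem_exp ::
  "('m::topological_space, 'e::euclidean_space) riem \<Rightarrow> 'm \<Rightarrow> ('m, 'e) tvec \<Rightarrow> 'm" where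
  "riem_exp M x v = (THE y. \<exists>\<gamma>. geodesic_on M \<gamma> {0..1} \<and> \<gamma> 0 = x \<and>
     velocity M \<gamma> {0..1} 0 = v \<and> \<gamma> 1 = y)"


subsection \<open>Differentiable functions and the gradient\<close>

definition differentiable_at_pt ::
  "('m, 'e::euclidean_space) riem \<Rightarrow> ('m \<Rightarrow> real) \<Rightarrow> 'm \<Rightarrow> bool" where
  "differentiable_at_pt M f x \<longleftrightarrow>
     (\<forall>c\<in>charts_at M x. (f \<circ> crd_inv c) differentiable (at (crd c x)))"

text \<open>The vector \<open>w\<close> with \<open>\<langle>w, v\<rangle>\<^sub>x = df\<^sub>x(v)\<close> for all \<open>v\<close>, where \<open>df\<^sub>x\<close> is computed in charts.\<close>

definition grad ::
  "('m, 'e::euclidean_space) riem \<Rightarrow> ('m \<Rightarrow> real) \<Rightarrow> 'm \<Rightarrow> ('m, 'e) tvec" where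
  "grad M f x = (THE w. w \<in> tangent_space M x \<and>
     (\<forall>v\<in>tangent_space M x. \<forall>c\<in>charts_at M x.
        rmetric M x w v = frechet_derivative (f \<circ> crd_inv c) (at (crd c x)) (v c)))"


section \<open>Riemannian Frank--Wolfe\<close>

definition rdiameter ::
  "('m::topological_space, 'e::euclidean_space) riem \<Rightarrow> 'm set \<Rightarrow> real" where
  "rdiameter M X = (SUP (x, y)\<in>X \<times> X. rdist M x y)"

definition weakly_min_geod_convex ::
  "('m::topological_space, 'e::euclidean_space) riem \<Rightarrow> 'm set \<Rightarrow> bool" where
  "weakly_min_geod_convex M X \<longleftrightarrow> (\<forall>x\<in>X. \<forall>y\<in>X.
     \<exists>\<gamma>. geodesic_on M \<gamma> {0..1} \<and> \<gamma> 0 = x \<and> \<gamma> 1 = y \<and>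
       path_length M \<gamma> = rdist M x y \<and> \<gamma> ` {0..1} \<subseteq> X)"

definition feasible_vel ::
  "('m::topological_space, 'e::euclidean_space) riem \<Rightarrow> 'm set \<Rightarrow> 'm \<Rightarrow> ('m, 'e) tvec set" where
  "feasible_vel M X x = {v \<in> tangent_space M x.
     riem_exp M x v \<in> X \<and>
     rnorm M x v = rdist M x (riem_exp M x v) \<and>
     (\<forall>t\<in>{0..1}. riem_exp M x (tscale t v) \<in> X)}"

definition subopt :: "('m \<Rightarrow> real) \<Rightarrow> 'm set \<Rightarrow> 'm \<Rightarrow> real" where
  "subopt f X x = f x - (INF y\<in>X. f y)"

definition regularity ::
  "('m::topological_space, 'e::euclidean_space) riem \<Rightarrow> 'm set \<Rightarrow> ('m \<Rightarrow> real) \<Rightarrow> real \<Rightarrow> bool" where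
  "regularity M X f L \<longleftrightarrow> (\<forall>x\<in>X. \<forall>v\<in>feasible_vel M X x. \<forall>t\<in>{0..1}.
     f (riem_exp M x (tscale t v)) \<le> (1 - t) * f x + t * f (riem_exp M x v) \<and>
     f (riem_exp M x (tscale t v))
       \<le> f x + t * rmetric M x (grad M f x) v + L / 2 * t\<^sup>2 * (rnorm M x v)\<^sup>2)"

definition RSI ::
  "('m::topological_space, 'e::euclidean_space) riem \<Rightarrow> 'm set \<Rightarrow> real \<Rightarrow> bool" where
  "RSI M X \<alpha> \<longleftrightarrow> (\<forall>x\<in>X. \<forall>w\<in>tangent_space M x. \<forall>v.
     is_arg_max (rmetric M x w) (\<lambda>u. u \<in> feasible_vel M X x) v \<longrightarrow>
     rmetric M x w v \<ge> \<alpha> * rnorm M x w * (rnorm M x v)\<^sup>2)"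

definition fw_gap ::
  "('m, 'e::euclidean_space) riem \<Rightarrow> ('m \<Rightarrow> real) \<Rightarrow> (nat \<Rightarrow> 'm) \<Rightarrow> (nat \<Rightarrow> ('m, 'e) tvec) \<Rightarrow> nat \<Rightarrow> real"
  where "fw_gap M f x v k = - rmetric M (x k) (grad M f (x k)) (v k)"

text \<open>A run of the algorithm: step \<open>k\<close> is carried out only if the algorithm has not terminated
  before, and the sequences are unconstrained after termination.\<close>

definition RFW_OL_run ::
  "('m::topological_space, 'e::euclidean_space) riem \<Rightarrow> 'm set \<Rightarrow> ('m \<Rightarrow> real) \<Rightarrow> real \<Rightarrow>
   (nat \<Rightarrow> 'm) \<Rightarrow> (nat \<Rightarrow> ('m, 'e) tvec) \<Rightarrow> bool" where
  "RFW_OL_run M X f a x v \<longleftrightarrow> x 0 \<in> X \<and>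
     (\<forall>k. (\<forall>j<k. fw_gap M f x v j \<noteq> 0) \<longrightarrow>
        is_arg_min (rmetric M (x k) (grad M f (x k))) (\<lambda>u. u \<in> feasible_vel M X (x k)) (v k) \<and>
        (fw_gap M f x v k \<noteq> 0 \<longrightarrow>
           x (Suc k) = riem_exp M (x k) (tscale (a / (real k + a)) (v k))))"

definition RFW_OL_terminates ::
  "('m, 'e::euclidean_space) riem \<Rightarrow> ('m \<Rightarrow> real) \<Rightarrow> (nat \<Rightarrow> 'm) \<Rightarrow> (nat \<Rightarrow> ('m, 'e) tvec) \<Rightarrow> bool"
  where "RFW_OL_terminates M f x v \<longleftrightarrow> (\<exists>k. fw_gap M f x v k = 0)"

definition min_grad_norm ::
  "('m, 'e::euclidean_space) riem \<Rightarrow> 'm set \<Rightarrow> ('m \<Rightarrow> real) \<Rightarrow> real" where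
  "min_grad_norm M X f = (INF x\<in>X. rnorm M x (grad M f x))"

definition M_RSI :: "real \<Rightarrow> real \<Rightarrow> real \<Rightarrow> real" where
  "M_RSI L \<alpha> \<nu> = L / (\<alpha> * \<nu>)"

definition K_RSI :: "real \<Rightarrow> real \<Rightarrow> int" where
  "K_RSI a m = max 1 \<lceil>a * m / 2 - a\<rceil>"

definition Khat_RSI :: "real \<Rightarrow> real \<Rightarrow> int" where
  "Khat_RSI a m = max (K_RSI a m) \<lceil>a * m - a\<rceil>"

text \<open>For \<open>k = 0\<close> the minimum is over the empty set and has no meaning.\<close>

definition rec_gap ::
  "('m, 'e::euclidean_space) riem \<Rightarrow> ('m \<Rightarrow> real) \<Rightarrow> (nat \<Rightarrow> 'm) \<Rightarrow> (nat \<Rightarrow> ('m, 'e) tvec) \<Rightarrow> nat \<Rightarrow> real"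
  where "rec_gap M f x v k = Min (fw_gap M f x v ` {k div 2..<k})"

end

theory Submission
  imports Defs
begin

text \<open>
  The exponential map and the gradient are definite descriptions, so first geodesics are shown to
  be determined by their initial velocity: by Gronwall's inequality in a chart, and then by
  considering the first time at which two geodesics separate. The initial velocity of a minimizing
  geodesic in \<open>X\<close> from \<open>x\<close> to a minimizer of \<open>f\<close> is therefore feasible, and convexity along it gives
  \<open>h \<le> g\<close>.

  The scaling inequality for the direction \<open>- grad f\<close> yields \<open>\<alpha> \<nu> \<parallel>v\<parallel>\<^sup>2 \<le> g\<close>, so with \<open>m = L / (\<alpha> \<nu>)\<close>
  smoothness becomes \<open>h\<^sub>k\<^sub>+\<^sub>1 \<le> h\<^sub>k - \<eta>\<^sub>k g\<^sub>k (1 - m \<eta>\<^sub>k / 2)\<close>. Together with \<open>h \<le> g\<close> this gives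
  \<open>h\<^sub>k = O(k powr (- a))\<close>. Once \<open>m \<eta>\<^sub>k \<le> 1\<close> it also gives \<open>\<eta>\<^sub>k g\<^sub>k \<le> 2 (h\<^sub>k - h\<^sub>k\<^sub>+\<^sub>1)\<close>; the sum over the second
  half of the first \<open>k\<close> steps telescopes, and the step sizes there sum to at least \<open>a ln (3/2)\<close>.
\<close>

section \<open>Multilinear estimates\<close>

text \<open>Expanding \<open>u\<close> in the finite basis leaves finitely many constants, so their
  sum works for all \<open>s\<close> at once. With weight \<open>N s = 1\<close> this is a uniform
  bound, with \<open>N s = norm (p - q)\<close> a Lipschitz bound.\<close>

lemma linear_bound_from_basis:
  fixes T :: "'s \<Rightarrow> 'e::euclidean_space \<Rightarrow> real"
  assumes lin: "\<And>s. s \<in> S \<Longrightarrow> linear (T s)"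
    and N: "\<And>s. s \<in> S \<Longrightarrow> 0 \<le> N s"
    and ex: "\<And>i. i \<in> Basis \<Longrightarrow> \<exists>C. \<forall>s\<in>S. \<bar>T s i\<bar> \<le> C * N s"
  shows "\<exists>C\<ge>0. \<forall>s\<in>S. \<forall>u. \<bar>T s u\<bar> \<le> C * N s * norm u"
proof -
  from ex have "\<forall>i\<in>Basis. \<exists>C. \<forall>s\<in>S. \<bar>T s i\<bar> \<le> C * N s" by blast
  from bchoice[OF this] obtain C where C: "\<And>i s. i \<in> Basis \<Longrightarrow> s \<in> S \<Longrightarrow> \<bar>T s i\<bar> \<le> C i * N s"
    by blast
  show ?thesis
  proof (intro exI[of _ "\<Sum>i\<in>Basis. \<bar>C i\<bar>"] conjI ballI allI)
    show "0 \<le> (\<Sum>i\<in>(Basis::'e set). \<bar>C i\<bar>)" by (simp add: sum_nonneg)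
    fix s u assume s: "s \<in> S"
    have "T s u = T s (\<Sum>i\<in>Basis. (u \<bullet> i) *\<^sub>R i)" by (simp add: euclidean_representation)
    also have "\<dots> = (\<Sum>i\<in>Basis. (u \<bullet> i) * T s i)"
      by (simp add: linear_sum[OF lin[OF s]] linear_scale[OF lin[OF s]])
    finally have "\<bar>T s u\<bar> \<le> (\<Sum>i\<in>Basis. \<bar>(u \<bullet> i) * T s i\<bar>)" by simp
    also have "\<dots> \<le> (\<Sum>i\<in>Basis. norm u * (\<bar>C i\<bar> * N s))"
    proof (rule sum_mono)
      fix i :: 'e assume i: "i \<in> Basis"
      have "C i * N s \<le> \<bar>C i\<bar> * N s" using N[OF s] by (simp add: mult_right_mono)
      with C[OF i s] have "\<bar>T s i\<bar> \<le> \<bar>C i\<bar> * N s" by linarith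
      then show "\<bar>(u \<bullet> i) * T s i\<bar> \<le> norm u * (\<bar>C i\<bar> * N s)"
        using Basis_le_norm[OF i, of u] by (auto simp: abs_mult intro!: mult_mono)
    qed
    also have "\<dots> = (\<Sum>i\<in>Basis. \<bar>C i\<bar>) * N s * norm u"
      by (simp add: sum_distrib_left sum_distrib_right mult_ac)
    finally show "\<bar>T s u\<bar> \<le> (\<Sum>i\<in>Basis. \<bar>C i\<bar>) * N s * norm u" .
  qed
qed

text \<open>The linear bound is used twice. The second time \<open>w\<close> joins the index, over
  \<open>S \<times> UNIV\<close>, and the weight becomes \<open>N s * norm w\<close>.\<close>

lemma bilinear_bound_from_basis:
  fixes T :: "'s \<Rightarrow> 'e::euclidean_space \<Rightarrow> 'e \<Rightarrow> real"
  assumes G_lin1: "\<And>s w. s \<in> S \<Longrightarrow> linear (\<lambda>u. T s u w)"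
    and G_lin2: "\<And>s u. s \<in> S \<Longrightarrow> linear (T s u)"
    and N: "\<And>s. s \<in> S \<Longrightarrow> 0 \<le> N s"
    and ex: "\<And>i j. i \<in> Basis \<Longrightarrow> j \<in> Basis \<Longrightarrow> \<exists>C. \<forall>s\<in>S. \<bar>T s i j\<bar> \<le> C * N s"
  shows "\<exists>C\<ge>0. \<forall>s\<in>S. \<forall>u w. \<bar>T s u w\<bar> \<le> C * N s * norm u * norm w"
proof -
  have A: "\<exists>C. \<forall>x\<in>S \<times> UNIV. \<bar>T (fst x) i (snd x)\<bar> \<le> C * (N (fst x) * norm (snd x))"
    if i: "i \<in> Basis" for i
    using linear_bound_from_basis[of S "\<lambda>s. T s i" N, OF G_lin2 N ex[OF i]] by (auto simp: mult_ac)
  have "\<exists>C\<ge>0. \<forall>x\<in>S\<times>UNIV. \<forall>u. \<bar>T (fst x) u (snd x)\<bar> \<le> C * (N (fst x) * norm (snd x)) * norm u"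
    by (rule linear_bound_from_basis[where T = "\<lambda>x u. T (fst x) u (snd x)"])
      (auto intro!: G_lin1 N A[simplified] mult_nonneg_nonneg)
  then show ?thesis by (force simp: mult_ac)
qed

text \<open>The last argument again becomes part of the index, which reduces the claim to the
  bilinear bound.\<close>

lemma trilinear_bound_from_basis:
  fixes T :: "'s \<Rightarrow> 'e::euclidean_space \<Rightarrow> 'e \<Rightarrow> 'e \<Rightarrow> real"
  assumes G_lin1: "\<And>s v w. s \<in> S \<Longrightarrow> linear (\<lambda>u. T s u v w)"
    and G_lin2: "\<And>s u w. s \<in> S \<Longrightarrow> linear (\<lambda>v. T s u v w)"
    and lin3: "\<And>s u v. s \<in> S \<Longrightarrow> linear (T s u v)"
    and N: "\<And>s. s \<in> S \<Longrightarrow> 0 \<le> N s"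
    and ex: "\<And>i j k. i \<in> Basis \<Longrightarrow> j \<in> Basis \<Longrightarrow> k \<in> Basis \<Longrightarrow> \<exists>C. \<forall>s\<in>S. \<bar>T s i j k\<bar> \<le> C * N s"
  shows "\<exists>C\<ge>0. \<forall>s\<in>S. \<forall>u v w. \<bar>T s u v w\<bar> \<le> C * N s * norm u * norm v * norm w"
proof -
  have A: "\<exists>C. \<forall>x\<in>S \<times> UNIV. \<bar>T (fst x) i j (snd x)\<bar> \<le> C * (N (fst x) * norm (snd x))"
    if i: "i \<in> Basis" "j \<in> Basis" for i j
    using linear_bound_from_basis[of S "\<lambda>s. T s i j" N, OF lin3 N ex[OF i]] by (auto simp: mult_ac)
  have "\<exists>C\<ge>0. \<forall>x\<in>S\<times>UNIV. \<forall>u v. \<bar>T (fst x) u v (snd x)\<bar> \<le> C * (N (fst x) * norm (snd x)) * norm u * norm v"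
    by (rule bilinear_bound_from_basis[where T = "\<lambda>x u v. T (fst x) u v (snd x)"])
      (auto intro!: G_lin1 G_lin2 N A[simplified] mult_nonneg_nonneg)
  then show ?thesis by (force simp: mult_ac)
qed

section \<open>Smooth functions on compact sets\<close>

lemma smooth_on_imp_differentiable:
  "smooth_on S F \<Longrightarrow> p \<in> S \<Longrightarrow> F differentiable (at p)"
  using Ck_on.simps(2)[of 0 S F] unfolding smooth_on_def by blast

lemma smooth_on_frechet_derivative:
  "smooth_on S F \<Longrightarrow> smooth_on S (\<lambda>p. frechet_derivative F (at p) u)"
  using Ck_on.simps(2)[of _ S F] unfolding smooth_on_def by blast

lemma smooth_on_imp_continuous_on: "smooth_on S F \<Longrightarrow> continuous_on S F"
  using Ck_on.simps(1) unfolding smooth_on_def by blast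

lemma smooth_on_bounded:
  fixes F :: "'a::euclidean_space \<Rightarrow> real"
  assumes "smooth_on S F" "compact K" "K \<subseteq> S"
  shows "\<exists>C. \<forall>p\<in>K. \<bar>F p\<bar> \<le> C"
proof -
  have "compact (F ` K)"
    using assms by (meson compact_continuous_image continuous_on_subset smooth_on_imp_continuous_on)
  from compact_imp_bounded[OF this] show ?thesis by (auto simp: bounded_iff)
qed

text \<open>Partial derivatives are continuous, hence bounded on \<open>K\<close>; convexity then
  allows the mean value inequality.\<close>

lemma smooth_on_lipschitz:
  fixes F :: "'a::euclidean_space \<Rightarrow> real"
  assumes F: "smooth_on S F" and K: "compact K" "convex K" "K \<subseteq> S"
  shows "\<exists>C. \<forall>p\<in>K. \<forall>q\<in>K. \<bar>F p - F q\<bar> \<le> C * norm (p - q)"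
proof -
  have d: "F differentiable (at p)" if "p \<in> K" for p
    using F K that smooth_on_imp_differentiable by blast
  have "\<exists>C. \<forall>p\<in>K. \<bar>frechet_derivative F (at p) i\<bar> \<le> C * 1" for i
    using smooth_on_bounded[OF smooth_on_frechet_derivative[OF F] K(1) K(3)] by simp
  then have "\<exists>C\<ge>0. \<forall>p\<in>K. \<forall>u. \<bar>frechet_derivative F (at p) u\<bar> \<le> C * 1 * norm u"
    by (intro linear_bound_from_basis linear_frechet_derivative d) auto
  then obtain C where C: "\<And>p u. p \<in> K \<Longrightarrow> \<bar>frechet_derivative F (at p) u\<bar> \<le> C * norm u"
    by auto
  have "norm (F p - F q) \<le> C * norm (p - q)" if "p \<in> K" "q \<in> K" for p q
  proof (rule differentiable_bound[OF K(2)])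
    show "(F has_derivative frechet_derivative F (at x)) (at x within K)" if "x \<in> K" for x
      using d[OF that] frechet_derivative_works has_derivative_at_withinI by blast
    show "onorm (frechet_derivative F (at x)) \<le> C" if "x \<in> K" for x
      by (rule onorm_le) (use C[OF that] in simp)
  qed (use that in auto)
  then show ?thesis by auto
qed

section \<open>Metrics on open sets of a Euclidean space\<close>

text \<open>The picture inside a single chart: \<open>U\<close> is the coordinate image and
  \<open>G p\<close> the inner product at \<open>p\<close>. The analysis of the geodesic equation is
  done here, free of manifold notions.\<close>

locale coord_metric =
  fixes U :: "'e::euclidean_space set" and G :: "'e \<Rightarrow> 'e \<Rightarrow> 'e \<Rightarrow> real"
  assumes open_U: "open U"
    and G_lin1: "p \<in> U \<Longrightarrow> linear (\<lambda>u. G p u w)"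
    and G_sym: "p \<in> U \<Longrightarrow> G p u w = G p w u"
    and G_pos: "p \<in> U \<Longrightarrow> u \<noteq> 0 \<Longrightarrow> G p u u > 0"
    and G_smooth: "smooth_on U (\<lambda>p. G p u w)"
begin

definition dG :: "'e \<Rightarrow> 'e \<Rightarrow> 'e \<Rightarrow> 'e \<Rightarrow> real" where
  "dG p h u w = frechet_derivative (\<lambda>q. G q u w) (at p) h"

text \<open>The Christoffel symbol of the first kind; in a chart it coincides with
  \<open>christoffel1\<close>.\<close>

definition chr :: "'e \<Rightarrow> 'e \<Rightarrow> 'e \<Rightarrow> 'e \<Rightarrow> real" where
  "chr p u v w = (dG p u v w + dG p v u w - dG p w u v) / 2"

lemma G_lin2: "p \<in> U \<Longrightarrow> linear (G p u)"
  using G_lin1[of p u] by (simp add: G_sym[of p _ u])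

lemma G_has_derivative: "p \<in> U \<Longrightarrow> ((\<lambda>q. G q u w) has_derivative (\<lambda>h. dG p h u w)) (at p)"
  unfolding dG_def using smooth_on_imp_differentiable[OF G_smooth] frechet_derivative_works by metis

lemma dG_sym: "p \<in> U \<Longrightarrow> dG p h u w = dG p h w u"
  unfolding dG_def
  by (rule fun_cong[OF frechet_derivative_transform_within_open[of _ p U]])
    (auto simp: open_U G_sym intro: smooth_on_imp_differentiable[OF G_smooth])

lemma dG_lin_dir: "p \<in> U \<Longrightarrow> linear (\<lambda>h. dG p h u w)"
  using G_has_derivative has_derivative_linear by blast

text \<open>Linearity of \<open>G q\<close> holds for all \<open>q\<close> in the open set
  \<open>U\<close>, so both sides are derivatives of functions that agree near \<open>p\<close>, and
  derivatives are unique.\<close>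

lemma dG_lin1: assumes p: "p \<in> U" shows "linear (\<lambda>u. dG p h u w)"
proof (rule linearI)
  fix u u'
  have "((\<lambda>q. G q u w + G q u' w) has_derivative (\<lambda>h. dG p h u w + dG p h u' w)) (at p)"
    by (intro has_derivative_add G_has_derivative p)
  moreover have "((\<lambda>q. G q u w + G q u' w) has_derivative (\<lambda>h. dG p h (u + u') w)) (at p)"
    by (rule has_derivative_transform_within_open[OF G_has_derivative[OF p] open_U p])
      (simp add: linear_add[OF G_lin1])
  ultimately have "(\<lambda>h. dG p h u w + dG p h u' w) = (\<lambda>h. dG p h (u + u') w)"
    by (rule has_derivative_unique)
  from fun_cong[OF this, of h] show "dG p h (u + u') w = dG p h u w + dG p h u' w" by simp
next
  fix r u
  have "((\<lambda>q. r * G q u w) has_derivative (\<lambda>h. r * dG p h u w)) (at p)"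
    by (intro has_derivative_mult_right G_has_derivative p)
  moreover have "((\<lambda>q. r * G q u w) has_derivative (\<lambda>h. dG p h (r *\<^sub>R u) w)) (at p)"
    by (rule has_derivative_transform_within_open[OF G_has_derivative[OF p] open_U p])
      (simp add: linear_scale[OF G_lin1])
  ultimately have "(\<lambda>h. r * dG p h u w) = (\<lambda>h. dG p h (r *\<^sub>R u) w)"
    by (rule has_derivative_unique)
  from fun_cong[OF this, of h] show "dG p h (r *\<^sub>R u) w = r *\<^sub>R dG p h u w" by simp
qed

lemma dG_lin2: "p \<in> U \<Longrightarrow> linear (\<lambda>w. dG p h u w)"
  using dG_lin1[of p h u] by (simp add: dG_sym[of p h _ u])

lemma chr_lin:
  assumes p: "p \<in> U"
  shows "linear (\<lambda>u. chr p u v w)" "linear (\<lambda>v. chr p u v w)" "linear (\<lambda>w. chr p u v w)"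
proof -
  have e: "chr = (\<lambda>p u v w. (1/2) *\<^sub>R (dG p u v w + dG p v u w - dG p w u v))"
    by (simp add: fun_eq_iff chr_def)
  show "linear (\<lambda>u. chr p u v w)" "linear (\<lambda>v. chr p u v w)" "linear (\<lambda>w. chr p u v w)"
    unfolding e by (intro linear_compose_scale_right linear_compose_add linear_compose_sub
        dG_lin1 dG_lin2 dG_lin_dir p)+
qed

text \<open>One constant for the three estimates of the Gronwall argument. Each comes from bounds on
  finitely many smooth coefficients over the compact convex set \<open>K\<close>.\<close>

lemma bounds:
  assumes K: "compact K" "convex K" "K \<subseteq> U"
  obtains C where "C \<ge> 0"
    "\<And>p q u w. p \<in> K \<Longrightarrow> q \<in> K \<Longrightarrow> \<bar>G p u w - G q u w\<bar> \<le> C * norm (p - q) * norm u * norm w"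
    "\<And>p u v w. p \<in> K \<Longrightarrow> \<bar>chr p u v w\<bar> \<le> C * norm u * norm v * norm w"
    "\<And>p q u v w. p \<in> K \<Longrightarrow> q \<in> K \<Longrightarrow>
       \<bar>chr p u v w - chr q u v w\<bar> \<le> C * norm (p - q) * norm u * norm v * norm w"
proof -
  have U: "p \<in> K \<Longrightarrow> p \<in> U" for p using K by auto
  have sm: "smooth_on U (\<lambda>p. dG p h u w)" for h u w
    unfolding dG_def by (rule smooth_on_frechet_derivative[OF G_smooth])
  have "\<exists>C\<ge>0. \<forall>s\<in>K\<times>K. \<forall>u w. \<bar>G (fst s) u w - G (snd s) u w\<bar> \<le> C * norm (fst s - snd s) * norm u * norm w"
  proof (rule bilinear_bound_from_basis)
    show "\<exists>C. \<forall>s\<in>K\<times>K. \<bar>G (fst s) i j - G (snd s) i j\<bar> \<le> C * norm (fst s - snd s)" for i j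
      using smooth_on_lipschitz[OF G_smooth K] by auto
  qed (auto intro!: linear_compose_sub G_lin1 G_lin2 U)
  then obtain C1 where C1: "C1 \<ge> 0" "\<And>p q u w. p \<in> K \<Longrightarrow> q \<in> K \<Longrightarrow>
      \<bar>G p u w - G q u w\<bar> \<le> C1 * norm (p - q) * norm u * norm w" by auto
  have "\<exists>C\<ge>0. \<forall>p\<in>K. \<forall>h u w. \<bar>dG p h u w\<bar> \<le> C * 1 * norm h * norm u * norm w"
  proof (rule trilinear_bound_from_basis)
    show "\<exists>C. \<forall>p\<in>K. \<bar>dG p i j k\<bar> \<le> C * 1" for i j k
      using smooth_on_bounded[OF sm K(1) K(3)] by auto
  qed (auto intro!: dG_lin1 dG_lin2 dG_lin_dir U)
  then obtain C2 where C2: "C2 \<ge> 0" "\<And>p h u w. p \<in> K \<Longrightarrow>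
      \<bar>dG p h u w\<bar> \<le> C2 * norm h * norm u * norm w" by auto
  have "\<exists>C\<ge>0. \<forall>s\<in>K\<times>K. \<forall>h u w. \<bar>dG (fst s) h u w - dG (snd s) h u w\<bar>
      \<le> C * norm (fst s - snd s) * norm h * norm u * norm w"
  proof (rule trilinear_bound_from_basis)
    show "\<exists>C. \<forall>s\<in>K\<times>K. \<bar>dG (fst s) i j k - dG (snd s) i j k\<bar> \<le> C * norm (fst s - snd s)" for i j k
      using smooth_on_lipschitz[OF sm K] by auto
  qed (auto intro!: linear_compose_sub dG_lin1 dG_lin2 dG_lin_dir U)
  then obtain C3 where C3: "C3 \<ge> 0" "\<And>p q h u w. p \<in> K \<Longrightarrow> q \<in> K \<Longrightarrow>
      \<bar>dG p h u w - dG q h u w\<bar> \<le> C3 * norm (p - q) * norm h * norm u * norm w" by auto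
  \<comment> \<open>\<open>chr\<close> is half of a combination of three values of
    \<open>dG\<close>, which costs a factor \<open>3/2\<close>; the coefficient \<open>2\<close>
    leaves room.\<close>
  define C where "C = C1 + 2 * C2 + 2 * C3"
  show thesis
  proof (rule that[of C])
    show "C \<ge> 0" using C1 C2 C3 by (simp add: C_def)
  next
    fix p q u w assume "p \<in> K" "q \<in> K"
    from C1(2)[OF this, of u w] have "\<bar>G p u w - G q u w\<bar> \<le> C1 * (norm (p - q) * norm u * norm w)"
      by (simp add: mult_ac)
    also have "\<dots> \<le> C * (norm (p - q) * norm u * norm w)"
      by (rule mult_right_mono) (use C1 C2 C3 in \<open>auto simp: C_def\<close>)
    finally show "\<bar>G p u w - G q u w\<bar> \<le> C * norm (p - q) * norm u * norm w" by (simp add: mult_ac)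
  next
    fix p u v w assume p: "p \<in> K"
    have "\<bar>chr p u v w\<bar> \<le> 3 / 2 * C2 * (norm u * norm v * norm w)"
      using C2(2)[OF p, of u v w] C2(2)[OF p, of v u w] C2(2)[OF p, of w u v]
      by (simp add: chr_def mult_ac)
    also have "\<dots> \<le> C * (norm u * norm v * norm w)"
      by (rule mult_right_mono) (use C1 C2 C3 in \<open>auto simp: C_def\<close>)
    finally show "\<bar>chr p u v w\<bar> \<le> C * norm u * norm v * norm w" by (simp add: mult_ac)
  next
    fix p q u v w :: 'e assume p: "p \<in> K" "q \<in> K"
    define N where "N = C3 * (norm (p - q) * norm u * norm v * norm w)"
    have "\<bar>dG p u v w - dG q u v w\<bar> \<le> N" "\<bar>dG p v u w - dG q v u w\<bar> \<le> N"
      "\<bar>dG p w u v - dG q w u v\<bar> \<le> N"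
      using C3(2)[OF p, of u v w] C3(2)[OF p, of v u w] C3(2)[OF p, of w u v]
      by (simp_all add: N_def mult_ac)
    then have "\<bar>chr p u v w - chr q u v w\<bar> \<le> 3 / 2 * N"
      unfolding chr_def abs_le_iff by (auto simp: field_simps)
    also have "\<dots> = 3 / 2 * C3 * (norm (p - q) * norm u * norm v * norm w)" by (simp add: N_def)
    also have "\<dots> \<le> C * (norm (p - q) * norm u * norm v * norm w)"
      by (rule mult_right_mono) (use C1 C2 C3 in \<open>auto simp: C_def\<close>)
    finally show "\<bar>chr p u v w - chr q u v w\<bar> \<le> C * norm (p - q) * norm u * norm v * norm w"
      by (simp add: mult_ac)
  qed
qed

text \<open>Smoothness is given only for fixed vectors. The expansion into coefficients yields
  continuity and derivatives when the base point and the vectors vary together.\<close>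

lemma G_expand:
  assumes p: "p \<in> U"
  shows "G p u w = (\<Sum>i\<in>Basis. \<Sum>j\<in>Basis. (u \<bullet> i) * (w \<bullet> j) * G p i j)"
proof -
  have "G p u w = G p (\<Sum>i\<in>Basis. (u \<bullet> i) *\<^sub>R i) (\<Sum>j\<in>Basis. (w \<bullet> j) *\<^sub>R j)"
    by (simp only: euclidean_representation)
  then show ?thesis
    by (simp add: linear_sum[OF G_lin1[OF p]] linear_scale[OF G_lin1[OF p]]
        linear_sum[OF G_lin2[OF p]] linear_scale[OF G_lin2[OF p]] sum_distrib_left mult.left_commute mult.assoc)
      (rule sum.swap)
qed

lemma dG_expand:
  assumes p: "p \<in> U"
  shows "dG p h u w = (\<Sum>i\<in>Basis. \<Sum>j\<in>Basis. (u \<bullet> i) * (w \<bullet> j) * dG p h i j)"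
proof -
  have "dG p h u w = dG p h (\<Sum>i\<in>Basis. (u \<bullet> i) *\<^sub>R i) (\<Sum>j\<in>Basis. (w \<bullet> j) *\<^sub>R j)"
    by (simp only: euclidean_representation)
  then show ?thesis
    by (simp add: linear_sum[OF dG_lin1[OF p]] linear_scale[OF dG_lin1[OF p]]
        linear_sum[OF dG_lin2[OF p]] linear_scale[OF dG_lin2[OF p]] sum_distrib_left mult.left_commute mult.assoc)
      (rule sum.swap)
qed

text \<open>A positive continuous function on the compact set \<open>K\<close> times the unit sphere
  has a positive minimum, and homogeneity extends the bound to all vectors.\<close>

lemma coercive:
  assumes K: "compact K" "K \<subseteq> U"
  obtains l where "l > 0" "\<And>p u. p \<in> K \<Longrightarrow> l * (norm u)\<^sup>2 \<le> G p u u"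
proof (cases "K = {}")
  case True
  then show thesis using that[of 1] by auto
next
  case False
  let ?S = "K \<times> sphere (0::'e) 1"
  let ?F = "\<lambda>x. \<Sum>i\<in>Basis. \<Sum>j\<in>Basis. (snd x \<bullet> i) * (snd x \<bullet> j) * G (fst x) i j"
  have c: "continuous_on ?S (\<lambda>x. G (fst x) i j)" for i j
    by (rule continuous_on_compose2[OF smooth_on_imp_continuous_on[OF G_smooth] continuous_on_fst])
      (use K in auto)
  have "continuous_on ?S ?F" by (intro continuous_intros c)
  moreover have "compact ?S" using K by (intro compact_Times) auto
  moreover obtain b :: 'e where "b \<in> Basis" by fastforce
  then have "?S \<noteq> {}" using False by (auto intro!: exI[of _ b])
  ultimately have "\<exists>y\<in>?S. \<forall>x\<in>?S. ?F y \<le> ?F x"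
    by (intro continuous_attains_inf)
  then obtain y where y: "y \<in> ?S" "\<And>x. x \<in> ?S \<Longrightarrow> ?F y \<le> ?F x" by blast
  have F: "?F x = G (fst x) (snd x) (snd x)" if "x \<in> ?S" for x
    using that K by (subst G_expand) auto
  have l: "?F y > 0" unfolding F[OF y(1)] using y(1) K by (intro G_pos) (auto simp: mem_Times_iff)
  show thesis
  proof (rule that[OF l])
    fix p u assume p: "p \<in> K"
    then have pU: "p \<in> U" using K by auto
    show "?F y * (norm u)\<^sup>2 \<le> G p u u"
    proof (cases "u = 0")
      case True then show ?thesis using linear_0[OF G_lin2[OF pU]] by simp
    next
      case False
      define e where "e = u /\<^sub>R norm u"
      have e: "(p, e) \<in> ?S" using p False by (simp add: e_def)
      have "?F y \<le> G p e e" using y(2)[OF e] F[OF e] by simp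
      moreover have "G p u u = (norm u)\<^sup>2 * G p e e"
        using False by (simp add: e_def linear_scale[OF G_lin1[OF pU]] linear_scale[OF G_lin2[OF pU]]
            power2_eq_square field_simps)
      ultimately show ?thesis using mult_left_mono[of "?F y" "G p e e" "(norm u)\<^sup>2"]
        by (simp only: mult.commute) simp
    qed
  qed
qed

text \<open>Gronwall's inequality for the squared distance of positions and velocities. Since the
  index of the equation is lowered, accelerations are estimated by testing with themselves and using
  coercivity, without inverting the metric.\<close>

lemma geodesic_ode_unique:
  fixes z1 z2 :: "real \<Rightarrow> 'e"
  assumes K: "compact K" "convex K" "K \<subseteq> U" and ab: "a \<le> b"
    and z1: "\<And>t. t \<in> {a..b} \<Longrightarrow> (z1 has_vector_derivative v1 t) (at t within {a..b})"
      "\<And>t. t \<in> {a..b} \<Longrightarrow> (v1 has_vector_derivative a1 t) (at t within {a..b})"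
      "\<And>t. t \<in> {a..b} \<Longrightarrow> z1 t \<in> K"
      "\<And>t w. t \<in> {a..b} \<Longrightarrow> G (z1 t) (a1 t) w + chr (z1 t) (v1 t) (v1 t) w = 0"
    and z2: "\<And>t. t \<in> {a..b} \<Longrightarrow> (z2 has_vector_derivative v2 t) (at t within {a..b})"
      "\<And>t. t \<in> {a..b} \<Longrightarrow> (v2 has_vector_derivative a2 t) (at t within {a..b})"
      "\<And>t. t \<in> {a..b} \<Longrightarrow> z2 t \<in> K"
      "\<And>t w. t \<in> {a..b} \<Longrightarrow> G (z2 t) (a2 t) w + chr (z2 t) (v2 t) (v2 t) w = 0"
    and init: "z1 a = z2 a" "v1 a = v2 a"
  shows "z1 b = z2 b"
proof -
  obtain C where C: "C \<ge> 0"
    "\<And>p q u w. p \<in> K \<Longrightarrow> q \<in> K \<Longrightarrow> \<bar>G p u w - G q u w\<bar> \<le> C * norm (p - q) * norm u * norm w"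
    "\<And>p u v w. p \<in> K \<Longrightarrow> \<bar>chr p u v w\<bar> \<le> C * norm u * norm v * norm w"
    "\<And>p q u v w. p \<in> K \<Longrightarrow> q \<in> K \<Longrightarrow>
       \<bar>chr p u v w - chr q u v w\<bar> \<le> C * norm (p - q) * norm u * norm v * norm w"
    using bounds[OF K] by metis
  obtain l where l: "l > 0" "\<And>p u. p \<in> K \<Longrightarrow> l * (norm u)\<^sup>2 \<le> G p u u"
    using coercive[OF K(1) K(3)] by metis
  have bdd: "\<exists>R. \<forall>t\<in>{a..b}. norm (v t) \<le> R"
    if "\<And>t. t \<in> {a..b} \<Longrightarrow> (v has_vector_derivative a' t) (at t within {a..b})"
    for v a' :: "real \<Rightarrow> 'e"
  proof -
    have "continuous_on {a..b} v" using that by (meson continuous_on_vector_derivative)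
    then have "bounded (v ` {a..b})" by (simp add: compact_continuous_image compact_imp_bounded)
    then show ?thesis by (auto simp: bounded_iff)
  qed
  obtain R1 R2 where "\<forall>t\<in>{a..b}. norm (v1 t) \<le> R1" "\<forall>t\<in>{a..b}. norm (v2 t) \<le> R2"
    using bdd[OF z1(2)] bdd[OF z2(2)] by blast
  then obtain R where R: "R \<ge> 0" "\<And>t. t \<in> {a..b} \<Longrightarrow> norm (v1 t) \<le> R" "\<And>t. t \<in> {a..b} \<Longrightarrow> norm (v2 t) \<le> R"
    by (intro that[of "max 0 (max R1 R2)"]) force+
  \<comment> \<open>Testing the second geodesic equation with its own acceleration gives
    \<open>l * (norm (a2 t))\<^sup>2 \<le> C * R\<^sup>2 * norm (a2 t)\<close>.\<close>
  define A where "A = C * R\<^sup>2 / l"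
  have A0: "A \<ge> 0" using C l by (simp add: A_def)
  have A: "norm (a2 t) \<le> A" if t: "t \<in> {a..b}" for t
  proof -
    have "l * (norm (a2 t))\<^sup>2 \<le> \<bar>chr (z2 t) (v2 t) (v2 t) (a2 t)\<bar>"
      using l(2)[OF z2(3)[OF t], of "a2 t"] z2(4)[OF t, of "a2 t"] by linarith
    also have "\<dots> \<le> C * norm (v2 t) * norm (v2 t) * norm (a2 t)" by (rule C(3)[OF z2(3)[OF t]])
    also have "\<dots> \<le> C * R * R * norm (a2 t)"
      using R t C by (intro mult_mono) auto
    finally have "norm (a2 t) * (l * norm (a2 t)) \<le> norm (a2 t) * (C * R\<^sup>2)"
      by (simp add: power2_eq_square mult_ac)
    then have "l * norm (a2 t) \<le> C * R\<^sup>2"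
      using C by (cases "a2 t = 0") auto
    then show ?thesis using l by (simp add: A_def field_simps)
  qed
  define B where "B = (C * A + C * R\<^sup>2 + 2 * C * R) / l"
  have B0: "B \<ge> 0" using C l R A0 by (simp add: B_def)
  have B: "norm (a1 t - a2 t) \<le> B * (norm (z1 t - z2 t) + norm (v1 t - v2 t))"
    if t: "t \<in> {a..b}" for t
  proof -
    let ?d = "norm (z1 t - z2 t)" and ?e = "norm (v1 t - v2 t)"
    define w where "w = a1 t - a2 t"
    have U: "z1 t \<in> U" "z2 t \<in> U" using z1(3)[OF t] z2(3)[OF t] K by auto
    have "G (z1 t) w w = G (z1 t) (a1 t) w - G (z1 t) (a2 t) w"
      by (simp add: linear_diff[OF G_lin1[OF U(1)]] w_def)
    \<comment> \<open>The two equations are subtracted so that only one thing changes at a time: the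
      base point of \<open>G\<close>, the base point of \<open>chr\<close>, and then each velocity
      slot of \<open>chr\<close>.\<close>
    also have "\<dots> = - (G (z1 t) (a2 t) w - G (z2 t) (a2 t) w)
        - (chr (z1 t) (v1 t) (v1 t) w - chr (z2 t) (v1 t) (v1 t) w)
        - (chr (z2 t) (v1 t - v2 t) (v1 t) w + chr (z2 t) (v2 t) (v1 t - v2 t) w)"
      using z1(4)[OF t, of w] z2(4)[OF t, of w]
      by (simp add: linear_diff[OF chr_lin(1)[OF U(2)]] linear_diff[OF chr_lin(2)[OF U(2)]])
    also have "\<dots> \<le> C * ?d * norm (a2 t) * norm w + C * ?d * norm (v1 t) * norm (v1 t) * norm w
        + (C * ?e * norm (v1 t) * norm w + C * norm (v2 t) * ?e * norm w)"
      using C(2)[OF z1(3)[OF t] z2(3)[OF t], of "a2 t" w]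
        C(4)[OF z1(3)[OF t] z2(3)[OF t], of "v1 t" "v1 t" w]
        C(3)[OF z2(3)[OF t], of "v1 t - v2 t" "v1 t" w] C(3)[OF z2(3)[OF t], of "v2 t" "v1 t - v2 t" w]
      by linarith
    also have "\<dots> \<le> C * ?d * A * norm w + C * ?d * R * R * norm w
        + (C * ?e * R * norm w + C * R * ?e * norm w)"
      using R t C A0 A[OF t] by (intro add_mono mult_mono mult_nonneg_nonneg) auto
    also have "\<dots> = norm w * ((C * A + C * R\<^sup>2) * ?d + 2 * C * R * ?e)"
      by (simp add: algebra_simps power2_eq_square)
    also have "\<dots> \<le> norm w * ((C * A + C * R\<^sup>2 + 2 * C * R) * ?d + (C * A + C * R\<^sup>2 + 2 * C * R) * ?e)"
      using C R A0 by (intro mult_left_mono add_mono[OF mult_right_mono mult_right_mono]) auto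
    also have "\<dots> = norm w * (l * (B * (?d + ?e)))"
      using l by (simp add: B_def field_simps)
    finally have "l * (norm w)\<^sup>2 \<le> norm w * (l * (B * (?d + ?e)))"
      using l(2)[OF z1(3)[OF t], of w] by linarith
    then have "norm w * (l * norm w) \<le> norm w * (l * (B * (?d + ?e)))"
      by (simp add: power2_eq_square mult_ac)
    then show ?thesis using l B0 unfolding w_def[symmetric]
      by (cases "w = 0") auto
  qed
  \<comment> \<open>With \<open>d\<close> and \<open>e\<close> the differences of position and
    velocity, \<open>2 * d * e \<le> d\<^sup>2 + e\<^sup>2\<close> contributes \<open>1 + B\<close>,
    and the remaining term in \<open>e\<^sup>2\<close> contributes \<open>2 * B\<close>.\<close>
  define Q where "Q = 1 + 3 * B"
  define \<phi> where "\<phi> t = (z1 t - z2 t) \<bullet> (z1 t - z2 t) + (v1 t - v2 t) \<bullet> (v1 t - v2 t)" for t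
  define \<phi>' where "\<phi>' t = 2 * ((z1 t - z2 t) \<bullet> (v1 t - v2 t)) + 2 * ((v1 t - v2 t) \<bullet> (a1 t - a2 t))" for t
  have d\<phi>: "(\<phi> has_real_derivative \<phi>' t) (at t within {a..b})" if t: "t \<in> {a..b}" for t
  proof -
    note z1(1)[OF t, unfolded has_vector_derivative_def, derivative_intros]
      z2(1)[OF t, unfolded has_vector_derivative_def, derivative_intros]
      z1(2)[OF t, unfolded has_vector_derivative_def, derivative_intros]
      z2(2)[OF t, unfolded has_vector_derivative_def, derivative_intros]
    show ?thesis unfolding \<phi>_def[abs_def] \<phi>'_def has_field_derivative_def
      by (rule derivative_eq_intros refl)+ (auto simp: fun_eq_iff algebra_simps inner_commute)
  qed
  have \<phi>_ineq: "\<phi>' t \<le> Q * \<phi> t" if t: "t \<in> {a..b}" for t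
  proof -
    let ?d = "norm (z1 t - z2 t)" and ?e = "norm (v1 t - v2 t)"
    have "(z1 t - z2 t) \<bullet> (v1 t - v2 t) \<le> ?d * ?e" by (rule norm_cauchy_schwarz)
    moreover have "(v1 t - v2 t) \<bullet> (a1 t - a2 t) \<le> ?e * (B * (?d + ?e))"
      by (rule order_trans[OF norm_cauchy_schwarz]) (intro mult_left_mono B t norm_ge_zero)
    ultimately have "\<phi>' t \<le> 2 * (?d * ?e) + 2 * (?e * (B * (?d + ?e)))" by (simp add: \<phi>'_def)
    also have "\<dots> = (1 + B) * (2 * ?d * ?e) + 2 * B * ?e\<^sup>2" by (simp add: algebra_simps power2_eq_square)
    also have "\<dots> \<le> (1 + B) * (?d\<^sup>2 + ?e\<^sup>2) + 2 * B * (?d\<^sup>2 + ?e\<^sup>2)"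
      using B0 sum_squares_bound[of ?d ?e] by (intro add_mono mult_left_mono) auto
    also have "\<dots> = Q * \<phi> t" by (simp add: Q_def \<phi>_def power2_norm_eq_inner algebra_simps)
    finally show ?thesis .
  qed
  \<comment> \<open>The integrating factor makes the derivative nonpositive. The mean value theorem
    needs \<open>a < b\<close>, hence the case split.\<close>
  have "\<phi> b * exp (- Q * b) \<le> \<phi> a * exp (- Q * a)"
  proof (cases "a = b")
    case False
    have "\<exists>t\<in>{a<..<b}. \<phi> b * exp (- Q * b) - \<phi> a * exp (- Q * a)
        = (b - a) * (\<phi>' t * exp (- Q * t) + \<phi> t * (- Q * exp (- Q * t)))"
      using False ab
    proof (intro mvt_simple)
      fix t assume t: "a \<le> t" "t \<le> b"
      have "((\<lambda>t. \<phi> t * exp (- Q * t)) has_real_derivative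
          (\<phi>' t * exp (- Q * t) + \<phi> t * (- Q * exp (- Q * t)))) (at t within {a..b})"
        by (rule derivative_eq_intros d\<phi> refl | use t in simp)+
      then show "((\<lambda>t. \<phi> t * exp (- Q * t)) has_derivative
          (\<lambda>x. x * (\<phi>' t * exp (- Q * t) + \<phi> t * (- Q * exp (- Q * t))))) (at t within {a..b})"
        by (simp add: has_field_derivative_def mult.commute[of _ "\<phi>' t * exp (- Q * t) + \<phi> t * (- Q * exp (- Q * t))"] mult_commute_abs)
    qed auto
    then obtain t where t: "t \<in> {a<..<b}" and eq: "\<phi> b * exp (- Q * b) - \<phi> a * exp (- Q * a)
        = (b - a) * (\<phi>' t * exp (- Q * t) + \<phi> t * (- Q * exp (- Q * t)))" by blast
    have "\<phi>' t * exp (- Q * t) + \<phi> t * (- Q * exp (- Q * t)) = (\<phi>' t - Q * \<phi> t) * exp (- Q * t)"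
      by (simp add: algebra_simps)
    also have "\<dots> \<le> 0" using \<phi>_ineq[of t] t by (intro mult_nonpos_nonneg) auto
    finally have "(b - a) * (\<phi>' t * exp (- Q * t) + \<phi> t * (- Q * exp (- Q * t))) \<le> 0"
      using ab by (intro mult_nonneg_nonpos) auto
    then show ?thesis using eq by linarith
  qed simp
  also have "\<phi> a = 0" by (simp add: \<phi>_def init)
  finally have "\<phi> b * exp (- Q * b) \<le> 0" by simp
  then have "\<phi> b \<le> 0" by (simp add: mult_le_0_iff)
  moreover have "(z1 b - z2 b) \<bullet> (z1 b - z2 b) \<le> \<phi> b" by (simp add: \<phi>_def)
  ultimately have "(z1 b - z2 b) \<bullet> (z1 b - z2 b) \<le> 0" by linarith
  then show ?thesis by (metis eq_iff_diff_eq_0 inner_eq_zero_iff inner_ge_zero order_antisym)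
qed

text \<open>The derivative of the energy is \<open>2 (G (z'', z') + \<Gamma> (z', z'; z'))\<close>, which vanishes along
  geodesics.\<close>

lemma energy_derivative_zero:
  fixes z :: "real \<Rightarrow> 'e"
  assumes t: "t \<in> I"
    and z: "(z has_vector_derivative v t) (at t within I)" "(v has_vector_derivative a) (at t within I)"
    and U: "z t \<in> U" and eq: "G (z t) a (v t) + chr (z t) (v t) (v t) (v t) = 0"
    and nb: "\<forall>\<^sub>F s in at t within I. z s \<in> U"
  shows "((\<lambda>s. G (z s) (v s) (v s)) has_real_derivative 0) (at t within I)"
proof -
  have Gd: "((\<lambda>s. G (z s) i j) has_real_derivative dG (z t) (v t) i j) (at t within I)" for i j
  proof -
    have "((\<lambda>q. G q i j) has_derivative (\<lambda>h. dG (z t) h i j)) (at (z t) within z ` I)"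
      using G_has_derivative[OF U] has_derivative_at_withinI by blast
    from vector_derivative_diff_chain_within[OF z(1) this]
    show ?thesis by (simp add: has_real_derivative_iff_has_vector_derivative o_def)
  qed
  have vd: "((\<lambda>s. v s \<bullet> i) has_real_derivative a \<bullet> i) (at t within I)" for i
    using bounded_linear.has_vector_derivative[OF bounded_linear_inner_left z(2)]
    by (simp add: has_real_derivative_iff_has_vector_derivative)
  \<comment> \<open>The coefficient sum is differentiated termwise. It equals the energy only where
    \<open>z s\<close> lies in \<open>U\<close>, which by \<open>nb\<close> is the case near
    \<open>t\<close>.\<close>
  have "((\<lambda>s. \<Sum>i\<in>Basis. \<Sum>j\<in>Basis. (v s \<bullet> i) * (v s \<bullet> j) * G (z s) i j) has_real_derivative
     (\<Sum>i\<in>Basis. \<Sum>j\<in>Basis. ((a \<bullet> i) * (v t \<bullet> j) + (a \<bullet> j) * (v t \<bullet> i)) * G (z t) i j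
        + dG (z t) (v t) i j * ((v t \<bullet> i) * (v t \<bullet> j)))) (at t within I)"
    by (intro DERIV_sum DERIV_mult Gd vd)
  also have "(\<Sum>i\<in>Basis. \<Sum>j\<in>Basis. ((a \<bullet> i) * (v t \<bullet> j) + (a \<bullet> j) * (v t \<bullet> i)) * G (z t) i j
        + dG (z t) (v t) i j * ((v t \<bullet> i) * (v t \<bullet> j)))
      = G (z t) a (v t) + G (z t) (v t) a + dG (z t) (v t) (v t) (v t)"
    by (simp add: G_expand[OF U, of a "v t"] G_expand[OF U, of "v t" a]
        dG_expand[OF U, of "v t" "v t" "v t"] sum.distrib[symmetric] algebra_simps)
  \<comment> \<open>With three equal arguments \<open>chr\<close> is half of \<open>dG\<close>, so
    the sum is twice the left side of \<open>eq\<close>.\<close>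
  also have "\<dots> = 0" using eq G_sym[OF U, of a "v t"] by (simp add: chr_def)
  finally have D: "((\<lambda>s. \<Sum>i\<in>Basis. \<Sum>j\<in>Basis. (v s \<bullet> i) * (v s \<bullet> j) * G (z s) i j)
      has_real_derivative 0) (at t within I)" .
  show ?thesis unfolding has_field_derivative_def
  proof (rule has_derivative_transform_eventually[OF D[unfolded has_field_derivative_def]])
    show "\<forall>\<^sub>F s in at t within I. (\<Sum>i\<in>Basis. \<Sum>j\<in>Basis. (v s \<bullet> i) * (v s \<bullet> j) * G (z s) i j)
        = G (z s) (v s) (v s)"
      using nb by eventually_elim (simp add: G_expand)
    show "(\<Sum>i\<in>Basis. \<Sum>j\<in>Basis. (v t \<bullet> i) * (v t \<bullet> j) * G (z t) i j) = G (z t) (v t) (v t)"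
      using U by (simp add: G_expand)
  qed (rule t)
qed

text \<open>The matrix of \<open>G p\<close> is injective, hence surjective.\<close>

lemma riesz:
  assumes p: "p \<in> U" and l: "linear l"
  shows "\<exists>u. \<forall>w. G p u w = l w"
proof -
  let ?T = "\<lambda>u. \<Sum>i\<in>Basis. G p u i *\<^sub>R i"
  have T: "?T u \<bullet> w = G p u w" for u w
  proof -
    have "G p u w = G p u (\<Sum>i\<in>Basis. (w \<bullet> i) *\<^sub>R i)" by (simp only: euclidean_representation)
    also have "\<dots> = ?T u \<bullet> w"
      unfolding inner_sum_left
      by (simp add: linear_sum[OF G_lin2[OF p]] linear_scale[OF G_lin2[OF p]]
          inner_commute[of w] mult.commute)
    finally show ?thesis by simp
  qed
  have lT: "linear ?T"
    by (rule linearI) (simp_all add: linear_add[OF G_lin1[OF p]] linear_scale[OF G_lin1[OF p]]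
        scaleR_left_distrib sum.distrib scaleR_sum_right)
  have "inj ?T" unfolding linear_injective_0[OF lT]
  proof (intro allI impI)
    fix u assume "?T u = 0"
    then have "G p u u = 0" using T[of u u] by simp
    then show "u = 0" using G_pos[OF p, of u] by force
  qed
  then have "surj ?T" by (rule linear_injective_imp_surjective[OF lT]) (rule refl)
  then obtain u where u: "(\<Sum>i\<in>Basis. l i *\<^sub>R i) = ?T u" by (blast dest: surjD)
  have "G p u w = (\<Sum>i\<in>Basis. l i *\<^sub>R i) \<bullet> w" for w unfolding u T ..
  also have "(\<Sum>i\<in>Basis. l i *\<^sub>R i) \<bullet> w = l (\<Sum>i\<in>Basis. (w \<bullet> i) *\<^sub>R i)" for w
    unfolding inner_sum_left
    by (simp add: linear_sum[OF l] linear_scale[OF l] inner_commute[of w] mult.commute)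
  finally have "G p u w = l w" for w by (simp only: euclidean_representation)
  then show ?thesis by blast
qed

end

section \<open>Riemannian manifolds\<close>

locale riemannian_mfd =
  fixes M :: "('m::{t2_space, second_countable_topology}, 'e::euclidean_space) riem"
  assumes riem: "riemannian_manifold M"
begin

section \<open>Charts and transition maps\<close>

lemma ex_chart: obtains c where "c \<in> charts_at M x"
proof -
  have "x \<in> (\<Union>c\<in>charts M. dom_ch c)"
    using riem unfolding riemannian_manifold_def smooth_atlas_def by simp
  then show thesis using that by (auto simp: charts_at_def)
qed

lemma chart_at_iff: "c \<in> charts_at M x \<longleftrightarrow> c \<in> charts M \<and> x \<in> dom_ch c"
  by (simp add: charts_at_def)

lemma chart:
  assumes "c \<in> charts M"
  shows open_dom: "open (dom_ch c)" and open_img: "open (crd c ` dom_ch c)"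
    and chart_homeo: "homeomorphism (dom_ch c) (crd c ` dom_ch c) (crd c) (crd_inv c)"
  using riem assms unfolding riemannian_manifold_def smooth_atlas_def by auto

lemma crd_inv_crd [simp]: "c \<in> charts M \<Longrightarrow> y \<in> dom_ch c \<Longrightarrow> crd_inv c (crd c y) = y"
  by (rule homeomorphism_apply1[OF chart_homeo])

lemma continuous_crd: "c \<in> charts M \<Longrightarrow> continuous_on (dom_ch c) (crd c)"
  by (rule homeomorphism_cont1[OF chart_homeo])

lemma open_img_inter:
  assumes c: "c \<in> charts M" "c' \<in> charts M"
  shows "open (crd c ` (dom_ch c \<inter> dom_ch c'))"
proof -
  have "openin (top_of_set (dom_ch c)) (dom_ch c \<inter> dom_ch c')"
    using open_dom[OF c(2)] by blast
  from homeomorphism_imp_open_map[OF chart_homeo[OF c(1)] this]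
  show ?thesis using open_img[OF c(1)] openin_open_trans by blast
qed

lemma transition_crd [simp]: "c \<in> charts M \<Longrightarrow> y \<in> dom_ch c \<Longrightarrow> transition c c' (crd c y) = crd c' y"
  by (simp add: transition_def)

definition dtrans :: "'m \<Rightarrow> ('m, 'e) chart \<Rightarrow> ('m, 'e) chart \<Rightarrow> 'e \<Rightarrow> 'e" where
  "dtrans x c c' = frechet_derivative (transition c c') (at (crd c x))"

lemma transition_has_derivative:
  assumes "c \<in> charts_at M x" "c' \<in> charts_at M x"
  shows "(transition c c' has_derivative dtrans x c c') (at (crd c x))"
proof -
  have "smooth_on (crd c ` (dom_ch c \<inter> dom_ch c')) (transition c c')"
    using riem assms unfolding riemannian_manifold_def smooth_atlas_def chart_at_iff by auto
  then have "transition c c' differentiable (at (crd c x))"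
    by (rule smooth_on_imp_differentiable) (use assms in \<open>auto simp: chart_at_iff\<close>)
  then show ?thesis unfolding dtrans_def using frechet_derivative_works by blast
qed

lemma dtrans_linear:
  "c \<in> charts_at M x \<Longrightarrow> c' \<in> charts_at M x \<Longrightarrow> linear (dtrans x c c')"
  using transition_has_derivative has_derivative_linear by blast

text \<open>The chain rule: on the open coordinate image of the overlap of \<open>c\<close> and
  \<open>c1\<close>, changing charts in two steps agrees with changing directly.\<close>

lemma dtrans_cocycle:
  assumes c: "c \<in> charts_at M x" "c1 \<in> charts_at M x" "c2 \<in> charts_at M x"
  shows "dtrans x c1 c2 (dtrans x c c1 u) = dtrans x c c2 u"
proof -
  have ch: "c \<in> charts M" "c1 \<in> charts M" "c2 \<in> charts M" and x: "x \<in> dom_ch c" "x \<in> dom_ch c1" "x \<in> dom_ch c2"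
    using c by (auto simp: chart_at_iff)
  have "(transition c1 c2 has_derivative dtrans x c1 c2) (at (transition c c1 (crd c x)))"
    using transition_has_derivative[OF c(2,3)] x ch by simp
  from diff_chain_at[OF transition_has_derivative[OF c(1,2)] this]
  have "(transition c1 c2 \<circ> transition c c1 has_derivative dtrans x c1 c2 \<circ> dtrans x c c1) (at (crd c x))" .
  then have "(transition c c2 has_derivative dtrans x c1 c2 \<circ> dtrans x c c1) (at (crd c x))"
    by (rule has_derivative_transform_within_open[OF _ open_img_inter[OF ch(1,2)]])
      (use x ch in auto)
  then have "dtrans x c1 c2 \<circ> dtrans x c c1 = dtrans x c c2"
    using transition_has_derivative[OF c(1,3)] by (rule has_derivative_unique)
  then show ?thesis by (simp add: fun_eq_iff)
qed

lemma dtrans_self: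
  assumes c: "c \<in> charts_at M x"
  shows "dtrans x c c u = u"
proof -
  have ch: "c \<in> charts M" "x \<in> dom_ch c" using c by (auto simp: chart_at_iff)
  have "(transition c c has_derivative (\<lambda>u. u)) (at (crd c x))"
    by (rule has_derivative_transform_within_open[OF has_derivative_ident open_img[OF ch(1)]])
      (use ch in auto)
  with transition_has_derivative[OF c c] have "dtrans x c c = (\<lambda>u. u)"
    by (rule has_derivative_unique)
  then show ?thesis by simp
qed

section \<open>Tangent vectors and the metric in coordinates\<close>

lemma coord_vec_apply: "c' \<in> charts_at M x \<Longrightarrow> coord_vec M x c u c' = dtrans x c c' u"
  by (simp add: coord_vec_def dtrans_def)

text \<open>The cocycle rule is exactly the compatibility between charts demanded of a tangent
  vector.\<close>

lemma coord_vec_tangent: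
  "c \<in> charts_at M x \<Longrightarrow> coord_vec M x c u \<in> tangent_space M x"
  unfolding tangent_space_def
  by (auto simp: coord_vec_apply dtrans_cocycle simp flip: dtrans_def) (simp add: coord_vec_def)

lemma coord_vec_same [simp]: "c \<in> charts_at M x \<Longrightarrow> coord_vec M x c u c = u"
  by (simp add: coord_vec_apply dtrans_self)

text \<open>With \<open>coord_vec_same\<close>, this identifies the tangent space with the model
  space through any one chart.\<close>

lemma coord_vec_coords:
  assumes "v \<in> tangent_space M x" "c \<in> charts_at M x"
  shows "coord_vec M x c (v c) = v"
proof
  fix c'
  have "c' \<in> charts_at M x \<Longrightarrow> v c' = frechet_derivative (transition c c') (at (crd c x)) (v c)"
    and "c' \<notin> charts_at M x \<Longrightarrow> v c' = 0"
    using assms unfolding tangent_space_def by blast+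
  then show "coord_vec M x c (v c) c' = v c'" by (simp add: coord_vec_def)
qed

lemma tangent_eqI:
  assumes "v \<in> tangent_space M x" "w \<in> tangent_space M x" "c \<in> charts_at M x" "v c = w c"
  shows "v = w"
  using assms coord_vec_coords by metis

lemma coord_vec_add:
  "c \<in> charts_at M x \<Longrightarrow> coord_vec M x c (u + w) = tadd (coord_vec M x c u) (coord_vec M x c w)"
  by (auto simp: tadd_def coord_vec_def fun_eq_iff linear_add[OF dtrans_linear] simp flip: dtrans_def)

lemma coord_vec_scale:
  "c \<in> charts_at M x \<Longrightarrow> coord_vec M x c (r *\<^sub>R u) = tscale r (coord_vec M x c u)"
  by (auto simp: tscale_def coord_vec_def fun_eq_iff linear_scale[OF dtrans_linear] simp flip: dtrans_def)

lemma inner_product: "is_inner_product_at M x"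
  using riem by (simp add: riemannian_manifold_def)

lemma rmetric_sym:
  "u \<in> tangent_space M x \<Longrightarrow> v \<in> tangent_space M x \<Longrightarrow> rmetric M x u v = rmetric M x v u"
  using inner_product[of x] by (simp add: is_inner_product_at_def)

lemma rmetric_tscale:
  "u \<in> tangent_space M x \<Longrightarrow> v \<in> tangent_space M x \<Longrightarrow> rmetric M x (tscale r u) v = r * rmetric M x u v"
  using inner_product[of x] by (simp add: is_inner_product_at_def)

lemma rmetric_nonneg:
  assumes u: "u \<in> tangent_space M x" shows "rmetric M x u u \<ge> 0"
proof (cases "u = tzero")
  case True
  \<comment> \<open>The zero vector is \<open>0\<close> times itself, so homogeneity makes its
    square vanish.\<close>
  have "tscale 0 u = u" using True by (simp add: tzero_def tscale_def)
  then show ?thesis using rmetric_tscale[OF u u, of 0] by simp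
next
  case False
  then show ?thesis using inner_product[of x] u by (auto simp: is_inner_product_at_def less_imp_le)
qed

lemma tscale_tangent:
  assumes v: "v \<in> tangent_space M x" shows "tscale r v \<in> tangent_space M x"
proof -
  obtain c where c: "c \<in> charts_at M x" by (rule ex_chart)
  then have "tscale r v = coord_vec M x c (r *\<^sub>R v c)"
    using v by (simp add: coord_vec_scale coord_vec_coords)
  then show ?thesis using c by (simp add: coord_vec_tangent)
qed

text \<open>This carries every fact of the locale over to each chart. Positivity holds because
  nonzero coordinates belong to a nonzero tangent vector.\<close>

lemma coord_metric:
  assumes c: "c \<in> charts M"
  shows "coord_metric (crd c ` dom_ch c) (metric_coeff M c)"
proof -
  have q: "c \<in> charts_at M (crd_inv c p)" if "p \<in> crd c ` dom_ch c" for p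
    using c that by (auto simp: chart_at_iff)
  note ip = inner_product[unfolded is_inner_product_at_def]
  have 1: "linear (\<lambda>u. metric_coeff M c p u w)" if "p \<in> crd c ` dom_ch c" for p w
    by (rule linearI)
      (use ip q[OF that] in \<open>simp_all add: metric_coeff_def coord_vec_add coord_vec_scale coord_vec_tangent\<close>)
  have 2: "metric_coeff M c p u w = metric_coeff M c p w u" if "p \<in> crd c ` dom_ch c" for p u w
    using q[OF that] by (simp add: metric_coeff_def rmetric_sym coord_vec_tangent)
  have 3: "metric_coeff M c p u u > 0" if "p \<in> crd c ` dom_ch c" "u \<noteq> 0" for p u
  proof -
    have "coord_vec M (crd_inv c p) c u \<noteq> tzero"
      using coord_vec_same[OF q[OF that(1)], of u] that(2) by (auto simp: tzero_def)
    then show ?thesis using ip by (simp add: metric_coeff_def coord_vec_tangent[OF q[OF that(1)]])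
  qed
  have 4: "smooth_on (crd c ` dom_ch c) (\<lambda>p. metric_coeff M c p u w)" for u w
    using riem c by (simp add: riemannian_manifold_def)
  show ?thesis by (rule coord_metric.intro[OF open_img[OF c] 1 2 3 4])
qed

lemma christoffel1_eq_chr:
  assumes c: "c \<in> charts M"
  shows "christoffel1 M c = coord_metric.chr (metric_coeff M c)"
  unfolding christoffel1_def[abs_def] coord_metric.chr_def[OF coord_metric[OF c], abs_def]
    coord_metric.dG_def[OF coord_metric[OF c]] ..

lemma rmetric_coords:
  assumes "u \<in> tangent_space M x" "v \<in> tangent_space M x" "c \<in> charts_at M x"
  shows "rmetric M x u v = metric_coeff M c (crd c x) (u c) (v c)"
  using assms by (simp add: metric_coeff_def coord_vec_coords chart_at_iff)

section \<open>Curves and their velocities\<close>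

lemma curve_near:
  fixes \<gamma> :: "real \<Rightarrow> 'm"
  assumes "continuous_on I \<gamma>" "t \<in> I" "open W" "\<gamma> t \<in> W"
  obtains \<delta> where "\<delta> > 0" "\<And>s. s \<in> I \<Longrightarrow> \<bar>s - t\<bar> \<le> \<delta> \<Longrightarrow> \<gamma> s \<in> W"
proof -
  have "openin (top_of_set I) (I \<inter> \<gamma> -` W)" by (rule continuous_openin_preimage_gen[OF assms(1,3)])
  then obtain \<delta> where \<delta>: "\<delta> > 0" "cball t \<delta> \<inter> I \<subseteq> I \<inter> \<gamma> -` W"
    unfolding openin_contains_cball using assms by blast
  show thesis
  proof (rule that[OF \<delta>(1)])
    fix s assume "s \<in> I" "\<bar>s - t\<bar> \<le> \<delta>"
    then have "s \<in> cball t \<delta> \<inter> I" by (simp add: dist_real_def abs_minus_commute)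
    then show "\<gamma> s \<in> W" using \<delta>(2) by blast
  qed
qed

lemma curve_eventually:
  fixes \<gamma> :: "real \<Rightarrow> 'm"
  assumes "continuous_on I \<gamma>" "t \<in> I" "open W" "\<gamma> t \<in> W"
  shows "\<forall>\<^sub>F s in at t within I. \<gamma> s \<in> W"
  by (rule topological_tendstoD[OF _ assms(3,4)]) (use assms(1,2) in \<open>simp add: continuous_on_def\<close>)

text \<open>Near \<open>t\<close> the curve stays in the chart, where
  \<open>F \<circ> \<gamma>\<close> factors through the coordinates. \<open>F\<close> will be the
  coordinate map of another chart or the objective function.\<close>

lemma curve_derivative_chain:
  fixes \<gamma> :: "real \<Rightarrow> 'm"
  assumes \<gamma>: "continuous_on I \<gamma>" "t \<in> I" and c: "c \<in> charts_at M (\<gamma> t)"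
    and d: "((crd c \<circ> \<gamma>) has_vector_derivative d) (at t within I)"
    and F: "((F \<circ> crd_inv c) has_derivative F') (at (crd c (\<gamma> t)))"
  shows "((F \<circ> \<gamma>) has_vector_derivative F' d) (at t within I)"
proof -
  have ch: "c \<in> charts M" "\<gamma> t \<in> dom_ch c" using c by (auto simp: chart_at_iff)
  have "((F \<circ> crd_inv c) has_derivative F') (at ((crd c \<circ> \<gamma>) t) within (crd c \<circ> \<gamma>) ` I)"
    using F has_derivative_at_withinI by force
  from vector_derivative_diff_chain_within[OF d this]
  have D: "((F \<circ> crd_inv c) \<circ> (crd c \<circ> \<gamma>) has_vector_derivative F' d) (at t within I)" .
  show ?thesis unfolding has_vector_derivative_def
    by (rule has_derivative_transform_eventually[OF D[unfolded has_vector_derivative_def]])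
      (use curve_eventually[OF \<gamma> open_dom[OF ch(1)] ch(2)] ch \<gamma>(2) in \<open>auto elim: eventually_mono\<close>)
qed

text \<open>The chain rule for the second coordinate map gives the transformation law, since
  derivatives within \<open>{0..1}\<close> are unique even at the end points.\<close>

lemma velocity_tangent:
  assumes \<gamma>: "continuous_on {0..1} \<gamma>" "t \<in> {0..1}"
    and d: "\<And>c. c \<in> charts_at M (\<gamma> t) \<Longrightarrow> (crd c \<circ> \<gamma>) differentiable (at t within {0..1})"
  shows "velocity M \<gamma> {0..1} t \<in> tangent_space M (\<gamma> t)"
  unfolding tangent_space_def
proof (intro CollectI conjI allI ballI impI)
  fix c assume "c \<notin> charts_at M (\<gamma> t)"
  then show "velocity M \<gamma> {0..1} t c = 0" by (simp add: velocity_def)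
next
  fix c c' assume c: "c \<in> charts_at M (\<gamma> t)" "c' \<in> charts_at M (\<gamma> t)"
  have 1: "((crd c \<circ> \<gamma>) has_vector_derivative velocity M \<gamma> {0..1} t c) (at t within {0..1})"
    if "c \<in> charts_at M (\<gamma> t)" for c
    using d[OF that] that by (simp add: velocity_def vector_derivative_works)
  have "((crd c' \<circ> \<gamma>) has_vector_derivative dtrans (\<gamma> t) c c' (velocity M \<gamma> {0..1} t c)) (at t within {0..1})"
    by (rule curve_derivative_chain[OF \<gamma> c(1) 1[OF c(1)]])
      (use transition_has_derivative[OF c] in \<open>simp add: transition_def\<close>)
  with 1[OF c(2)] have "velocity M \<gamma> {0..1} t c' = dtrans (\<gamma> t) c c' (velocity M \<gamma> {0..1} t c)"
    using \<gamma>(2) by (intro vector_derivative_unique_within_closed_interval[of 0 1 t]) (auto simp: cbox_interval)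
  then show "velocity M \<gamma> {0..1} t c'
      = frechet_derivative (transition c c') (at (crd c (\<gamma> t))) (velocity M \<gamma> {0..1} t c)"
    by (simp add: dtrans_def)
qed

subsection \<open>Geodesics\<close>

text \<open>\<open>crd_vel\<close> and \<open>crd_acc\<close> name the first and second coordinate
  derivatives in \<open>geodesic_on\<close> on the unit interval; they are one-sided at the end
  points.\<close>

definition crd_vel :: "(real \<Rightarrow> 'm) \<Rightarrow> ('m, 'e) chart \<Rightarrow> real \<Rightarrow> 'e" where
  "crd_vel \<gamma> c t = vector_derivative (crd c \<circ> \<gamma>) (at t within {0..1})"

definition crd_acc :: "(real \<Rightarrow> 'm) \<Rightarrow> ('m, 'e) chart \<Rightarrow> real \<Rightarrow> 'e" where
  "crd_acc \<gamma> c t = vector_derivative (crd_vel \<gamma> c) (at t within {0..1})"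

lemma geodesic_on_continuous: "geodesic_on M \<gamma> I \<Longrightarrow> continuous_on I \<gamma>"
  by (simp add: geodesic_on_def)

lemma geodesic_coords:
  assumes g: "geodesic_on M \<gamma> {0..1}" and t: "t \<in> {0..1}" and c: "c \<in> charts_at M (\<gamma> t)"
  shows "((crd c \<circ> \<gamma>) has_vector_derivative crd_vel \<gamma> c t) (at t within {0..1})"
    and "(crd_vel \<gamma> c has_vector_derivative crd_acc \<gamma> c t) (at t within {0..1})"
    and "metric_coeff M c (crd c (\<gamma> t)) (crd_acc \<gamma> c t) w
      + christoffel1 M c (crd c (\<gamma> t)) (crd_vel \<gamma> c t) (crd_vel \<gamma> c t) w = 0"
proof -
  have "(crd c \<circ> \<gamma>) differentiable (at t within {0..1})
      \<and> crd_vel \<gamma> c differentiable (at t within {0..1})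
      \<and> (\<forall>w. metric_coeff M c ((crd c \<circ> \<gamma>) t) (crd_acc \<gamma> c t) w
      + christoffel1 M c ((crd c \<circ> \<gamma>) t) (crd_vel \<gamma> c t) (crd_vel \<gamma> c t) w = 0)"
    using g t c unfolding geodesic_on_def Let_def crd_acc_def crd_vel_def[abs_def] by blast
  then show "((crd c \<circ> \<gamma>) has_vector_derivative crd_vel \<gamma> c t) (at t within {0..1})"
    and "(crd_vel \<gamma> c has_vector_derivative crd_acc \<gamma> c t) (at t within {0..1})"
    and "metric_coeff M c (crd c (\<gamma> t)) (crd_acc \<gamma> c t) w
      + christoffel1 M c (crd c (\<gamma> t)) (crd_vel \<gamma> c t) (crd_vel \<gamma> c t) w = 0"
    unfolding vector_derivative_works by (auto simp: crd_vel_def crd_acc_def)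
qed

lemma geodesic_velocity:
  assumes "c \<in> charts_at M (\<gamma> t)"
  shows "velocity M \<gamma> {0..1} t c = crd_vel \<gamma> c t"
  using assms by (simp add: velocity_def crd_vel_def)

lemma geodesic_velocity_tangent:
  assumes g: "geodesic_on M \<gamma> {0..1}" and t: "t \<in> {0..1}"
  shows "velocity M \<gamma> {0..1} t \<in> tangent_space M (\<gamma> t)"
  by (rule velocity_tangent[OF geodesic_on_continuous[OF g] t])
    (rule differentiableI_vector[OF geodesic_coords(1)[OF g t]])

text \<open>Around the last common point both curves stay for a short time in one coordinate ball,
  where the Euclidean uniqueness result applies.\<close>

lemma geodesic_unique_local:
  assumes g: "geodesic_on M \<gamma>1 {0..1}" "geodesic_on M \<gamma>2 {0..1}"
    and T: "0 \<le> T" "T < 1"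
    and eq: "\<And>t. t \<in> {0..T} \<Longrightarrow> \<gamma>1 t = \<gamma>2 t"
    and init: "velocity M \<gamma>1 {0..1} 0 = velocity M \<gamma>2 {0..1} 0"
  obtains b where "b > T" "\<And>t. t \<in> {T..b} \<Longrightarrow> t \<le> 1 \<Longrightarrow> \<gamma>1 t = \<gamma>2 t"
proof -
  have T1: "T \<in> {0..1}" using T by auto
  obtain c where c: "c \<in> charts_at M (\<gamma>1 T)" by (rule ex_chart)
  have eqT: "\<gamma>2 T = \<gamma>1 T" using eq T by auto
  have ch: "c \<in> charts M" "\<gamma>1 T \<in> dom_ch c" using c by (auto simp: chart_at_iff)
  interpret coord_metric "crd c ` dom_ch c" "metric_coeff M c" by (rule coord_metric[OF ch(1)])
  have "crd c (\<gamma>1 T) \<in> crd c ` dom_ch c" using ch by auto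
  then obtain r where r: "r > 0" "cball (crd c (\<gamma>1 T)) r \<subseteq> crd c ` dom_ch c"
    using open_img[OF ch(1)] open_contains_cball by meson
  \<comment> \<open>The closed ball is the compact convex set for
    \<open>geodesic_ode_unique\<close>; the open ball makes \<open>W\<close> a
    neighbourhood.\<close>
  define W where "W = dom_ch c \<inter> crd c -` ball (crd c (\<gamma>1 T)) r"
  have W: "open W" "\<gamma>1 T \<in> W" "\<gamma>2 T \<in> W"
    unfolding W_def using ch r eqT
    by (auto intro: continuous_open_preimage[OF continuous_crd open_dom])
  obtain d1 where d1: "d1 > 0" "\<And>s. s \<in> {0..1} \<Longrightarrow> \<bar>s - T\<bar> \<le> d1 \<Longrightarrow> \<gamma>1 s \<in> W"
    using curve_near[OF geodesic_on_continuous[OF g(1)] T1 W(1) W(2)] by metis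
  obtain d2 where d2: "d2 > 0" "\<And>s. s \<in> {0..1} \<Longrightarrow> \<bar>s - T\<bar> \<le> d2 \<Longrightarrow> \<gamma>2 s \<in> W"
    using curve_near[OF geodesic_on_continuous[OF g(2)] T1 W(1) W(3)] by metis
  have c2: "c \<in> charts_at M (\<gamma>2 T)" using c eqT by simp
  have vel: "crd_vel \<gamma>1 c T = crd_vel \<gamma>2 c T"
  \<comment> \<open>For \<open>T > 0\<close> the left derivatives agree because the curves agree on
    \<open>{0..T}\<close>. That interval is degenerate for \<open>T = 0\<close>, where the initial
    velocities are used.\<close>
  proof (cases "T = 0")
    case True
    then show ?thesis using fun_cong[OF init, of c] c c2 by (simp add: geodesic_velocity)
  next
    case False
    have D: "((crd c \<circ> \<gamma>) has_vector_derivative crd_vel \<gamma> c T) (at T within {0..T})"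
      if "geodesic_on M \<gamma> {0..1}" "c \<in> charts_at M (\<gamma> T)" for \<gamma>
      by (rule has_vector_derivative_within_subset[OF geodesic_coords(1)[OF that(1) T1 that(2)]])
        (use T in auto)
    have "((crd c \<circ> \<gamma>2) has_vector_derivative crd_vel \<gamma>1 c T) (at T within {0..T})"
      by (rule has_vector_derivative_transform[OF _ _ D[OF g(1) c]]) (use T eq in auto)
    with D[OF g(2) c2] show ?thesis
      using T False
      by (intro vector_derivative_unique_within_closed_interval[of 0 T T]) (auto simp: cbox_interval)
  qed
  show thesis
  proof (rule that[of "T + min d1 d2"])
    show "T + min d1 d2 > T" using d1 d2 by simp
    fix b assume b: "b \<in> {T..T + min d1 d2}" "b \<le> 1"
    have W12: "\<gamma>1 t \<in> W" "\<gamma>2 t \<in> W" if "t \<in> {T..b}" for t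
      using that b T by (auto intro!: d1 d2)
    have D: "((crd c \<circ> \<gamma>) has_vector_derivative crd_vel \<gamma> c t) (at t within {T..b})"
       "(crd_vel \<gamma> c has_vector_derivative crd_acc \<gamma> c t) (at t within {T..b})"
       "(crd c \<circ> \<gamma>) t \<in> cball (crd c (\<gamma>1 T)) r"
       "metric_coeff M c ((crd c \<circ> \<gamma>) t) (crd_acc \<gamma> c t) w
          + chr ((crd c \<circ> \<gamma>) t) (crd_vel \<gamma> c t) (crd_vel \<gamma> c t) w = 0"
      if \<gamma>: "geodesic_on M \<gamma> {0..1}" and t: "t \<in> {T..b}" and W: "\<gamma> t \<in> W" for \<gamma> t w
    proof -
      have t': "t \<in> {0..1}" "{T..b} \<subseteq> {0..1}" using t b T by auto
      have ct: "c \<in> charts_at M (\<gamma> t)" using W ch by (auto simp: W_def chart_at_iff)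
      note gc = geodesic_coords[OF \<gamma> t'(1) ct]
      show "((crd c \<circ> \<gamma>) has_vector_derivative crd_vel \<gamma> c t) (at t within {T..b})"
        by (rule has_vector_derivative_within_subset[OF gc(1) t'(2)])
      show "(crd_vel \<gamma> c has_vector_derivative crd_acc \<gamma> c t) (at t within {T..b})"
        by (rule has_vector_derivative_within_subset[OF gc(2) t'(2)])
      show "(crd c \<circ> \<gamma>) t \<in> cball (crd c (\<gamma>1 T)) r"
        using W by (simp add: W_def)
      show "metric_coeff M c ((crd c \<circ> \<gamma>) t) (crd_acc \<gamma> c t) w
          + chr ((crd c \<circ> \<gamma>) t) (crd_vel \<gamma> c t) (crd_vel \<gamma> c t) w = 0"
        using gc(3)[of w] by (simp add: christoffel1_eq_chr[OF ch(1)])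
    qed
    \<comment> \<open>The uniqueness result speaks only of the right end point, so it is applied on
      \<open>{T..b}\<close> for each \<open>b\<close>.\<close>
    have "(crd c \<circ> \<gamma>1) b = (crd c \<circ> \<gamma>2) b"
    proof (rule geodesic_ode_unique[OF compact_cball convex_cball r(2)])
      show "T \<le> b" using b by simp
      show "(crd c \<circ> \<gamma>1) T = (crd c \<circ> \<gamma>2) T" using eqT by simp
    qed (use D[OF g(1)] D[OF g(2)] W12 vel in blast)+
    moreover have "\<gamma>1 b \<in> dom_ch c" "\<gamma>2 b \<in> dom_ch c" using W12[of b] b by (auto simp: W_def)
    ultimately show "\<gamma>1 b = \<gamma>2 b" using crd_inv_crd[OF ch(1)] by (metis comp_apply)
  qed
qed

text \<open>Let \<open>T\<close> be the infimum of the times of disagreement. The curves agree up to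
  and including \<open>T\<close>, and local uniqueness carries the agreement beyond
  \<open>T\<close>.\<close>

lemma geodesic_unique:
  assumes g: "geodesic_on M \<gamma>1 {0..1}" "geodesic_on M \<gamma>2 {0..1}"
    and init: "\<gamma>1 0 = \<gamma>2 0" "velocity M \<gamma>1 {0..1} 0 = velocity M \<gamma>2 {0..1} 0"
    and t: "t \<in> {0..1}"
  shows "\<gamma>1 t = \<gamma>2 t"
proof (rule ccontr)
  assume ne: "\<gamma>1 t \<noteq> \<gamma>2 t"
  define E where "E = {t\<in>{0..1}. \<gamma>1 t \<noteq> \<gamma>2 t}"
  define T where "T = Inf E"
  have E: "t \<in> E" "bdd_below E" using ne t by (auto simp: E_def intro!: bdd_belowI[of _ 0])
  have T: "0 \<le> T" "T \<le> t"
    using E by (auto simp: T_def E_def intro: cInf_greatest cInf_lower)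
  have before: "\<gamma>1 s = \<gamma>2 s" if "0 \<le> s" "s < T" for s
  proof (rule ccontr)
    assume "\<gamma>1 s \<noteq> \<gamma>2 s"
    then have "s \<in> E" using that T t by (auto simp: E_def)
    then have "T \<le> s" unfolding T_def using E(2) by (rule cInf_lower)
    then show False using that by simp
  qed
  \<comment> \<open>Both values are limits from the left of the same points, and limits in a
    Hausdorff space are unique.\<close>
  have at: "\<gamma>1 T = \<gamma>2 T"
  proof (cases "T = 0")
    case False
    then have "0 < T" using T by simp
    then have "T islimpt {0<..<T}" by (rule islimpt_greaterThanLessThan2)
    then have nt: "at T within {0<..<T} \<noteq> bot"
      by (simp add: trivial_limit_within)
    have l: "(\<gamma> \<longlongrightarrow> \<gamma> T) (at T within {0<..<T})" if "geodesic_on M \<gamma> {0..1}" for \<gamma>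
    proof -
      have "(\<gamma> \<longlongrightarrow> \<gamma> T) (at T within {0..1})"
        using geodesic_on_continuous[OF that] T t by (auto simp: continuous_on_def)
      then show ?thesis by (rule tendsto_within_subset) (use T t in auto)
    qed
    have "\<forall>\<^sub>F s in at T within {0<..<T}. \<gamma>1 s = \<gamma>2 s"
      by (auto simp: eventually_at_filter before)
    then have "(\<gamma>2 \<longlongrightarrow> \<gamma>1 T) (at T within {0<..<T})"
      using l[OF g(1)] tendsto_cong by blast
    then show ?thesis using tendsto_unique[OF nt] l[OF g(2)] by blast
  qed (use init in simp)
  have upto: "\<gamma>1 s = \<gamma>2 s" if "s \<in> {0..T}" for s using before[of s] at that by force
  have "T < 1"
  proof (rule ccontr)
    assume "\<not> T < 1"
    then have "t = T" using T t by auto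
    then show False using at ne by simp
  qed
  from geodesic_unique_local[OF g T(1) this upto init(2)]
  obtain b where b: "b > T" "\<And>t. t \<in> {T..b} \<Longrightarrow> t \<le> 1 \<Longrightarrow> \<gamma>1 t = \<gamma>2 t" by metis
  \<comment> \<open>No time of disagreement lies before \<open>b\<close>, so the infimum is at least
    \<open>b\<close>.\<close>
  have "b \<le> T" unfolding T_def
  proof (rule cInf_greatest)
    fix s assume "s \<in> E"
    then have s: "s \<in> {0..1}" "\<gamma>1 s \<noteq> \<gamma>2 s" by (auto simp: E_def)
    then show "b \<le> s" using upto[of s] b(2)[of s] by force
  qed (use E in auto)
  then show False using b by simp
qed

text \<open>Uniqueness at time \<open>1\<close> makes the definite description meaningful, with
  \<open>\<gamma>\<close> itself as the witness of existence.\<close>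

lemma riem_exp_geodesic:
  assumes g: "geodesic_on M \<gamma> {0..1}"
  shows "riem_exp M (\<gamma> 0) (velocity M \<gamma> {0..1} 0) = \<gamma> 1"
  unfolding riem_exp_def
proof (rule the_equality)
  fix y assume "\<exists>\<gamma>'. geodesic_on M \<gamma>' {0..1} \<and> \<gamma>' 0 = \<gamma> 0
    \<and> velocity M \<gamma>' {0..1} 0 = velocity M \<gamma> {0..1} 0 \<and> \<gamma>' 1 = y"
  then show "y = \<gamma> 1" using geodesic_unique[OF _ g, of _ 1] by auto
qed (use g in blast)

text \<open>Slowing down by \<open>r\<close> multiplies the acceleration and the quadratic velocity
  term both by \<open>r * r\<close>, so the equation survives. For \<open>r = 0\<close> the result
  is a constant geodesic.\<close>

lemma geodesic_rescale:
  assumes g: "geodesic_on M \<gamma> {0..1}" and r: "r \<in> {0..1}"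
  shows "geodesic_on M (\<lambda>s. \<gamma> (r * s)) {0..1}"
    and "velocity M (\<lambda>s. \<gamma> (r * s)) {0..1} 0 = tscale r (velocity M \<gamma> {0..1} 0)"
proof -
  let ?\<gamma> = "\<lambda>s. \<gamma> (r * s)"
  have I: "r * s \<in> {0..1}" if "s \<in> {0..1}" for s using r that by (auto simp: mult_le_one)
  have cont: "continuous_on {0..1} ?\<gamma>"
    by (rule continuous_on_compose2[OF geodesic_on_continuous[OF g]])
      (use I in \<open>auto intro!: continuous_intros\<close>)
  have chain: "((\<lambda>s. z (r * s)) has_vector_derivative r *\<^sub>R z') (at s within {0..1})"
    if s: "s \<in> {0..1}" and z: "(z has_vector_derivative z') (at (r * s) within {0..1})" for s z and z' :: 'e
  proof -
    have "((\<lambda>s. r * s) has_vector_derivative r) (at s within {0..1})"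
      by (auto intro!: derivative_eq_intros)
    moreover have "(z has_vector_derivative z') (at (r * s) within (\<lambda>s. r * s) ` {0..1})"
      by (rule has_vector_derivative_within_subset[OF z]) (use I in auto)
    ultimately show ?thesis using vector_diff_chain_within[of "\<lambda>s. r * s" r s "{0..1}" z z']
      by (simp add: o_def)
  qed
  have vd: "vector_derivative z (at s within {0..1}) = z'"
    if "(z has_vector_derivative z') (at s within {0..1})" "s \<in> {0..1}" for s z and z' :: 'e
    using that by (intro vector_derivative_within_cbox[of 0 1 s, unfolded cbox_interval]) auto
  have v: "((crd c \<circ> ?\<gamma>) has_vector_derivative r *\<^sub>R crd_vel \<gamma> c (r * s)) (at s within {0..1})"
    if "s \<in> {0..1}" "c \<in> charts_at M (\<gamma> (r * s))" for s c
    using chain[OF that(1) geodesic_coords(1)[OF g I[OF that(1)] that(2)]] by (simp add: o_def)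
  have a: "(crd_vel ?\<gamma> c has_vector_derivative r *\<^sub>R (r *\<^sub>R crd_acc \<gamma> c (r * s))) (at s within {0..1})"
    if s: "s \<in> {0..1}" and c: "c \<in> charts_at M (\<gamma> (r * s))" for s c
  proof -
    have ch: "c \<in> charts M" "?\<gamma> s \<in> dom_ch c" using c by (auto simp: chart_at_iff)
    have D: "((\<lambda>s. r *\<^sub>R crd_vel \<gamma> c (r * s)) has_vector_derivative r *\<^sub>R (r *\<^sub>R crd_acc \<gamma> c (r * s)))
        (at s within {0..1})"
      by (intro bounded_linear.has_vector_derivative[OF bounded_linear_scaleR_right] chain s
          geodesic_coords(2)[OF g I[OF s] c])
    have eq: "r *\<^sub>R crd_vel \<gamma> c (r * s') = crd_vel ?\<gamma> c s'" if "s' \<in> {0..1}" "?\<gamma> s' \<in> dom_ch c" for s'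
      using vd[OF v[OF that(1), of c] that(1)] that(2) ch by (simp add: crd_vel_def chart_at_iff)
    \<comment> \<open>Differentiating once more needs the velocity formula near \<open>s\<close>,
      not only at \<open>s\<close>.\<close>
    have ev: "\<forall>\<^sub>F s' in at s within {0..1}. r *\<^sub>R crd_vel \<gamma> c (r * s') = crd_vel ?\<gamma> c s'"
      using curve_eventually[OF cont s open_dom[OF ch(1)] ch(2)]
      by (auto simp: eventually_at_filter eq elim: eventually_mono)
    show ?thesis unfolding has_vector_derivative_def
      by (rule has_derivative_transform_eventually[OF D[unfolded has_vector_derivative_def] ev])
        (use eq[OF s ch(2)] s in auto)
  qed
  show "geodesic_on M ?\<gamma> {0..1}"
    unfolding geodesic_on_def Let_def
  proof (intro conjI ballI cont allI)
    fix s c w assume s: "s \<in> {0..1::real}" and c: "c \<in> charts_at M (\<gamma> (r * s))"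
    show "(crd c \<circ> ?\<gamma>) differentiable (at s within {0..1})"
      using v[OF s c] differentiableI_vector by blast
    have 1: "crd_vel ?\<gamma> c s = r *\<^sub>R crd_vel \<gamma> c (r * s)"
      using vd[OF v[OF s c] s] by (simp add: crd_vel_def)
    have 2: "vector_derivative (crd_vel ?\<gamma> c) (at s within {0..1}) = r *\<^sub>R (r *\<^sub>R crd_acc \<gamma> c (r * s))"
      by (rule vd[OF a[OF s c] s])
    show "(\<lambda>s. vector_derivative (crd c \<circ> ?\<gamma>) (at s within {0..1})) differentiable (at s within {0..1})"
      using a[OF s c] differentiableI_vector by (simp add: crd_vel_def[abs_def]) blast
    have ch: "c \<in> charts M" and p: "crd c (\<gamma> (r * s)) \<in> crd c ` dom_ch c"
      using c by (auto simp: chart_at_iff)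
    interpret coord_metric "crd c ` dom_ch c" "metric_coeff M c" by (rule coord_metric[OF ch])
    have "metric_coeff M c (crd c (\<gamma> (r * s))) (r *\<^sub>R (r *\<^sub>R crd_acc \<gamma> c (r * s))) w
        + chr (crd c (\<gamma> (r * s))) (r *\<^sub>R crd_vel \<gamma> c (r * s)) (r *\<^sub>R crd_vel \<gamma> c (r * s)) w
        = r * r * (metric_coeff M c (crd c (\<gamma> (r * s))) (crd_acc \<gamma> c (r * s)) w
        + chr (crd c (\<gamma> (r * s))) (crd_vel \<gamma> c (r * s)) (crd_vel \<gamma> c (r * s)) w)"
      by (simp add: linear_scale[OF G_lin1[OF p]] linear_scale[OF chr_lin(1)[OF p]]
          linear_scale[OF chr_lin(2)[OF p]] algebra_simps)
    also have "\<dots> = 0"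
      using geodesic_coords(3)[OF g I[OF s] c, of w] by (simp add: christoffel1_eq_chr[OF ch])
    finally show "metric_coeff M c ((crd c \<circ> ?\<gamma>) s)
        (vector_derivative (\<lambda>s. vector_derivative (crd c \<circ> ?\<gamma>) (at s within {0..1})) (at s within {0..1})) w
      + christoffel1 M c ((crd c \<circ> ?\<gamma>) s) (vector_derivative (crd c \<circ> ?\<gamma>) (at s within {0..1}))
          (vector_derivative (crd c \<circ> ?\<gamma>) (at s within {0..1})) w = 0"
      unfolding crd_vel_def[symmetric] 1 2 christoffel1_eq_chr[OF ch] by simp
  qed
  show "velocity M ?\<gamma> {0..1} 0 = tscale r (velocity M \<gamma> {0..1} 0)"
  proof
    fix c
    show "velocity M ?\<gamma> {0..1} 0 c = tscale r (velocity M \<gamma> {0..1} 0) c"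
    proof (cases "c \<in> charts_at M (\<gamma> 0)")
      case True
      then show ?thesis using vd[OF v[of 0 c]] by (simp add: velocity_def tscale_def crd_vel_def)
    qed (simp add: velocity_def tscale_def)
  qed
qed

lemma riem_exp_geodesic_scaled:
  assumes g: "geodesic_on M \<gamma> {0..1}" and r: "r \<in> {0..1}"
  shows "riem_exp M (\<gamma> 0) (tscale r (velocity M \<gamma> {0..1} 0)) = \<gamma> r"
  using riem_exp_geodesic[OF geodesic_rescale(1)[OF g r]] geodesic_rescale(2)[OF g r] by simp

text \<open>The squared speed does not depend on the chart, so its derivative may be computed at
  each time in any chart around the point, where \<open>energy_derivative_zero\<close>
  applies.\<close>

lemma geodesic_constant_speed:
  assumes g: "geodesic_on M \<gamma> {0..1}" and t: "t \<in> {0..1}"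
  shows "rnorm M (\<gamma> t) (velocity M \<gamma> {0..1} t) = rnorm M (\<gamma> 0) (velocity M \<gamma> {0..1} 0)"
proof -
  let ?e = "\<lambda>t. rmetric M (\<gamma> t) (velocity M \<gamma> {0..1} t) (velocity M \<gamma> {0..1} t)"
  have "(?e has_field_derivative 0) (at s within {0..1})" if s: "s \<in> {0..1}" for s
  proof -
    obtain c where c: "c \<in> charts_at M (\<gamma> s)" by (rule ex_chart)
    then have ch: "c \<in> charts M" "\<gamma> s \<in> dom_ch c" by (auto simp: chart_at_iff)
    interpret coord_metric "crd c ` dom_ch c" "metric_coeff M c" by (rule coord_metric[OF ch(1)])
    note ev = curve_eventually[OF geodesic_on_continuous[OF g] s open_dom[OF ch(1)] ch(2)]
    have D: "((\<lambda>s. metric_coeff M c ((crd c \<circ> \<gamma>) s) (crd_vel \<gamma> c s) (crd_vel \<gamma> c s)) has_real_derivative 0)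
        (at s within {0..1})"
    proof (rule energy_derivative_zero[OF s])
      show "\<forall>\<^sub>F s in at s within {0..1}. (crd c \<circ> \<gamma>) s \<in> crd c ` dom_ch c"
        using ev by eventually_elim auto
      show "metric_coeff M c ((crd c \<circ> \<gamma>) s) (crd_acc \<gamma> c s) (crd_vel \<gamma> c s)
          + chr ((crd c \<circ> \<gamma>) s) (crd_vel \<gamma> c s) (crd_vel \<gamma> c s) (crd_vel \<gamma> c s) = 0"
        using geodesic_coords(3)[OF g s c] by (simp add: christoffel1_eq_chr[OF ch(1)])
      show "(crd c \<circ> \<gamma>) s \<in> crd c ` dom_ch c" using ch by simp
    qed (rule geodesic_coords[OF g s c])+
    have eq: "metric_coeff M c ((crd c \<circ> \<gamma>) s) (crd_vel \<gamma> c s) (crd_vel \<gamma> c s) = ?e s"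
      if "s \<in> {0..1}" "\<gamma> s \<in> dom_ch c" for s
    proof -
      have "c \<in> charts_at M (\<gamma> s)" using that ch by (simp add: chart_at_iff)
      then show ?thesis
        using rmetric_coords[OF geodesic_velocity_tangent[OF g that(1)] geodesic_velocity_tangent[OF g that(1)]]
        by (simp add: geodesic_velocity)
    qed
    show ?thesis unfolding has_field_derivative_def
      by (rule has_derivative_transform_eventually[OF D[unfolded has_field_derivative_def]])
        (use ev eq ch s in \<open>auto simp: eventually_at_filter elim!: eventually_mono\<close>)
  qed
  then have "\<exists>k. \<forall>s\<in>{0..1}. ?e s = k"
    by (intro has_field_derivative_zero_constant) auto
  then have "?e t = ?e 0" using t by force
  then show ?thesis by (simp add: rnorm_def)
qed

lemma geodesic_length:
  assumes g: "geodesic_on M \<gamma> {0..1}"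
  shows "path_length M \<gamma> = rnorm M (\<gamma> 0) (velocity M \<gamma> {0..1} 0)"
proof -
  have "path_length M \<gamma> = integral {0..1::real} (\<lambda>t. rnorm M (\<gamma> 0) (velocity M \<gamma> {0..1} 0))"
    unfolding path_length_def by (rule integral_cong) (rule geodesic_constant_speed[OF g])
  then show ?thesis by simp
qed

text \<open>By constant speed the norm of the initial velocity is the length, hence the distance; by
  rescaling, the exponential map of its multiples traces \<open>\<gamma>\<close>.\<close>

lemma minimizing_geodesic_feasible:
  assumes g: "geodesic_on M \<gamma> {0..1}" and "path_length M \<gamma> = rdist M (\<gamma> 0) (\<gamma> 1)"
    and "\<gamma> ` {0..1} \<subseteq> X"
  shows "velocity M \<gamma> {0..1} 0 \<in> feasible_vel M X (\<gamma> 0)"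
  unfolding feasible_vel_def
proof (intro CollectI conjI ballI)
  show "velocity M \<gamma> {0..1} 0 \<in> tangent_space M (\<gamma> 0)" using geodesic_velocity_tangent[OF g] by simp
  show "riem_exp M (\<gamma> 0) (velocity M \<gamma> {0..1} 0) \<in> X"
    unfolding riem_exp_geodesic[OF g] using assms(3) by auto
  show "rnorm M (\<gamma> 0) (velocity M \<gamma> {0..1} 0)
      = rdist M (\<gamma> 0) (riem_exp M (\<gamma> 0) (velocity M \<gamma> {0..1} 0))"
    unfolding riem_exp_geodesic[OF g] using assms(2) geodesic_length[OF g] by simp
  show "riem_exp M (\<gamma> 0) (tscale t (velocity M \<gamma> {0..1} 0)) \<in> X" if "t \<in> {0..1}" for t
    unfolding riem_exp_geodesic_scaled[OF g that] using assms(3) that by auto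
qed

subsection \<open>Gradients\<close>

text \<open>Near \<open>x\<close> the function factors through a chart. Continuity is what makes
  \<open>f\<close> attain its minimum on the compact set.\<close>

lemma differentiable_at_pt_continuous:
  assumes f: "differentiable_at_pt M f x" shows "isCont f x"
proof -
  obtain c where c: "c \<in> charts_at M x" by (rule ex_chart)
  then have ch: "c \<in> charts M" "x \<in> dom_ch c" by (auto simp: chart_at_iff)
  have "isCont (crd c) x"
    using continuous_crd[OF ch(1)] open_dom[OF ch(1)] ch(2) by (simp add: continuous_on_eq_continuous_at)
  moreover have "isCont (f \<circ> crd_inv c) (crd c x)"
    using f c by (auto simp: differentiable_at_pt_def intro: differentiable_imp_continuous_within)
  ultimately have "isCont ((f \<circ> crd_inv c) \<circ> crd c) x" by (rule continuous_at_compose)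
  moreover have "\<forall>\<^sub>F y in nhds x. ((f \<circ> crd_inv c) \<circ> crd c) y = f y"
    using eventually_nhds_in_open[OF open_dom[OF ch(1)] ch(2)] by eventually_elim (simp add: ch)
  ultimately show ?thesis by (simp add: isCont_cong)
qed

text \<open>The chain rule for the transition map: the differential of \<open>f\<close> at
  \<open>x\<close> does not depend on the chart.\<close>

lemma differential_coords:
  assumes f: "differentiable_at_pt M f x" and v: "v \<in> tangent_space M x"
    and c: "c \<in> charts_at M x" "c' \<in> charts_at M x"
  shows "frechet_derivative (f \<circ> crd_inv c') (at (crd c' x)) (v c')
    = frechet_derivative (f \<circ> crd_inv c) (at (crd c x)) (v c)"
proof -
  have ch: "c \<in> charts M" "x \<in> dom_ch c" "c' \<in> charts M" "x \<in> dom_ch c'"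
    using c by (auto simp: chart_at_iff)
  have D: "((f \<circ> crd_inv c) has_derivative frechet_derivative (f \<circ> crd_inv c) (at (crd c x))) (at (crd c x))"
    if "c \<in> charts_at M x" for c
    using f that frechet_derivative_works by (auto simp: differentiable_at_pt_def)
  have "((f \<circ> crd_inv c') \<circ> transition c c' has_derivative
      frechet_derivative (f \<circ> crd_inv c') (at (crd c' x)) \<circ> dtrans x c c') (at (crd c x))"
    by (rule diff_chain_at[OF transition_has_derivative[OF c]]) (use D[OF c(2)] ch in simp)
  then have "((f \<circ> crd_inv c) has_derivative
      frechet_derivative (f \<circ> crd_inv c') (at (crd c' x)) \<circ> dtrans x c c') (at (crd c x))"
    by (rule has_derivative_transform_within_open[OF _ open_img_inter[OF ch(1,3)]])
      (use ch in auto)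
  then have "frechet_derivative (f \<circ> crd_inv c') (at (crd c' x)) \<circ> dtrans x c c'
      = frechet_derivative (f \<circ> crd_inv c) (at (crd c x))"
    using D[OF c(1)] by (rule has_derivative_unique)
  moreover have "v c' = dtrans x c c' (v c)"
    using v c unfolding tangent_space_def dtrans_def by blast
  ultimately show ?thesis by (metis comp_apply)
qed

text \<open>Riesz representation in one chart gives a candidate, and chart independence of the
  differential extends its property to all charts. Positivity gives the uniqueness needed for the
  definite description.\<close>

lemma grad:
  assumes f: "differentiable_at_pt M f x"
  shows grad_tangent: "grad M f x \<in> tangent_space M x"
    and rmetric_grad: "\<And>v c. v \<in> tangent_space M x \<Longrightarrow> c \<in> charts_at M x \<Longrightarrow>
      rmetric M x (grad M f x) v = frechet_derivative (f \<circ> crd_inv c) (at (crd c x)) (v c)"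
proof -
  let ?P = "\<lambda>w. w \<in> tangent_space M x \<and> (\<forall>v\<in>tangent_space M x. \<forall>c\<in>charts_at M x.
        rmetric M x w v = frechet_derivative (f \<circ> crd_inv c) (at (crd c x)) (v c))"
  obtain c where c: "c \<in> charts_at M x" by (rule ex_chart)
  then have ch: "c \<in> charts M" and p: "crd c x \<in> crd c ` dom_ch c" by (auto simp: chart_at_iff)
  interpret coord_metric "crd c ` dom_ch c" "metric_coeff M c" by (rule coord_metric[OF ch])
  have "linear (frechet_derivative (f \<circ> crd_inv c) (at (crd c x)))"
    using f c by (auto simp: differentiable_at_pt_def intro: linear_frechet_derivative)
  then obtain u where u: "\<And>w. metric_coeff M c (crd c x) u w
      = frechet_derivative (f \<circ> crd_inv c) (at (crd c x)) w" using riesz[OF p] by blast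
  have P: "?P (coord_vec M x c u)"
  proof (intro conjI ballI coord_vec_tangent c)
    fix v c' assume v: "v \<in> tangent_space M x" and c': "c' \<in> charts_at M x"
    have "rmetric M x (coord_vec M x c u) v = frechet_derivative (f \<circ> crd_inv c) (at (crd c x)) (v c)"
      using u by (simp add: rmetric_coords[OF coord_vec_tangent[OF c] v c] c)
    also have "\<dots> = frechet_derivative (f \<circ> crd_inv c') (at (crd c' x)) (v c')"
      by (rule differential_coords[OF f v c' c])
    finally show "rmetric M x (coord_vec M x c u) v
      = frechet_derivative (f \<circ> crd_inv c') (at (crd c' x)) (v c')" .
  qed
  have "w = w'" if w: "?P w" "?P w'" for w w'
  proof (rule tangent_eqI[of _ x _ c])
    let ?d = "w c - w' c"
    have "rmetric M x w (coord_vec M x c ?d) = rmetric M x w' (coord_vec M x c ?d)"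
      using w c coord_vec_tangent[OF c] by auto
    then have "metric_coeff M c (crd c x) (w c) ?d = metric_coeff M c (crd c x) (w' c) ?d"
      using w c by (simp add: rmetric_coords[OF _ _ c] coord_vec_tangent)
    then have "metric_coeff M c (crd c x) ?d ?d = 0" by (simp add: linear_diff[OF G_lin1[OF p]])
    then show "w c = w' c" using G_pos[OF p, of ?d] by force
  qed (use w c in auto)
  with P have "\<exists>!w. ?P w" by blast
  from theI'[OF this] have "?P (grad M f x)" unfolding grad_def .
  then show "grad M f x \<in> tangent_space M x"
    and "\<And>v c. v \<in> tangent_space M x \<Longrightarrow> c \<in> charts_at M x \<Longrightarrow>
      rmetric M x (grad M f x) v = frechet_derivative (f \<circ> crd_inv c) (at (crd c x)) (v c)"
    by auto
qed

lemma geodesic_grad: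
  assumes g: "geodesic_on M \<gamma> {0..1}" and f: "differentiable_at_pt M f (\<gamma> 0)"
  shows "((f \<circ> \<gamma>) has_real_derivative rmetric M (\<gamma> 0) (grad M f (\<gamma> 0)) (velocity M \<gamma> {0..1} 0))
    (at 0 within {0..1})"
proof -
  obtain c where c: "c \<in> charts_at M (\<gamma> 0)" by (rule ex_chart)
  have F: "((f \<circ> crd_inv c) has_derivative frechet_derivative (f \<circ> crd_inv c) (at (crd c (\<gamma> 0)))) (at (crd c (\<gamma> 0)))"
    using f c frechet_derivative_works by (auto simp: differentiable_at_pt_def)
  have "((f \<circ> \<gamma>) has_vector_derivative frechet_derivative (f \<circ> crd_inv c) (at (crd c (\<gamma> 0))) (crd_vel \<gamma> c 0))
      (at 0 within {0..1})"
    by (rule curve_derivative_chain[OF geodesic_on_continuous[OF g] _ c _ F])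
      (use geodesic_coords(1)[OF g _ c] in auto)
  then show ?thesis
    using rmetric_grad[OF f geodesic_velocity_tangent[OF g] c] c
    by (simp add: geodesic_velocity has_real_derivative_iff_has_vector_derivative)
qed

end

section \<open>Frank--Wolfe\<close>

context riemannian_mfd
begin

text \<open>Along a minimizing geodesic to a minimizer \<open>y\<close>, convexity bounds the
  difference quotients by \<open>f y - f x\<close>. Their limit at \<open>0\<close> is the pairing
  of the gradient with a feasible velocity, and \<open>v\<close> does at least as well.\<close>

lemma subopt_le_fw_gap:
  assumes wgc: "weakly_min_geod_convex M X" and reg: "regularity M X f L"
    and x: "x \<in> X" and f: "differentiable_at_pt M f x"
    and min: "y \<in> X" "\<And>z. z \<in> X \<Longrightarrow> f y \<le> f z"
    and v: "\<And>u. u \<in> feasible_vel M X x \<Longrightarrow> rmetric M x (grad M f x) v \<le> rmetric M x (grad M f x) u"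
  shows "subopt f X x \<le> - rmetric M x (grad M f x) v"
proof -
  obtain \<gamma> where g: "geodesic_on M \<gamma> {0..1}" "\<gamma> 0 = x" "\<gamma> 1 = y"
    "path_length M \<gamma> = rdist M x y" "\<gamma> ` {0..1} \<subseteq> X"
    using wgc x min(1) unfolding weakly_min_geod_convex_def by blast
  let ?u = "velocity M \<gamma> {0..1} 0"
  let ?D = "rmetric M x (grad M f x) ?u"
  have u: "?u \<in> feasible_vel M X x"
    using minimizing_geodesic_feasible[OF g(1)] g by simp
  have conv: "f (\<gamma> t) \<le> (1 - t) * f x + t * f y" if t: "t \<in> {0..1}" for t
    using reg x u t riem_exp_geodesic[OF g(1)] riem_exp_geodesic_scaled[OF g(1) t] g(2,3)
    unfolding regularity_def by metis
  have "((f \<circ> \<gamma>) has_real_derivative ?D) (at 0 within {0..1})"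
    using geodesic_grad[OF g(1)] f g(2) by simp
  then have lim: "((\<lambda>t. (f (\<gamma> t) - f x) / t) \<longlongrightarrow> ?D) (at 0 within {0..1})"
    using g(2) by (simp add: has_field_derivative_iff)
  have "?D \<le> f y - f x"
  proof (rule tendsto_upperbound[OF lim])
    show "\<forall>\<^sub>F t in at 0 within {0..1}. (f (\<gamma> t) - f x) / t \<le> f y - f x"
      unfolding eventually_at_filter
    proof (intro always_eventually allI impI)
      fix t :: real assume "t \<noteq> 0" "t \<in> {0..1}"
      then show "(f (\<gamma> t) - f x) / t \<le> f y - f x"
        using conv[of t] by (subst pos_divide_le_eq) (auto simp: algebra_simps)
    qed
    have "(0::real) islimpt {0..1}"
      by (rule islimpt_subset[OF islimpt_greaterThanLessThan1[of 0 1]]) auto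
    then show "at (0::real) within {0..1} \<noteq> bot" by (simp add: trivial_limit_within)
  qed
  moreover have "(INF z\<in>X. f z) = f y"
    using min by (intro cInf_eq_minimum) auto
  ultimately show ?thesis using v[OF u] by (simp add: subopt_def)
qed

text \<open>Minimizing against the gradient is maximizing against its negative, so the scaling
  inequality applies to the latter; its norm is bounded below by the infimum of the gradient
  norms.\<close>

lemma RSI_norm_bound:
  assumes RSI: "RSI M X \<alpha>" and "\<alpha> > 0" and x: "x \<in> X" and f: "\<And>y. y \<in> X \<Longrightarrow> differentiable_at_pt M f y"
    and v: "is_arg_min (rmetric M x (grad M f x)) (\<lambda>u. u \<in> feasible_vel M X x) v"
  shows "\<alpha> * min_grad_norm M X f * (rnorm M x v)\<^sup>2 \<le> - rmetric M x (grad M f x) v"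
proof -
  let ?w = "tscale (-1) (grad M f x)"
  have gT: "grad M f x \<in> tangent_space M x" using grad_tangent[OF f[OF x]] .
  have feas: "u \<in> tangent_space M x" if "u \<in> feasible_vel M X x" for u
    using that by (simp add: feasible_vel_def)
  have w: "rmetric M x ?w u = - rmetric M x (grad M f x) u" if "u \<in> tangent_space M x" for u
    using rmetric_tscale[OF gT that] by simp
  have "is_arg_max (rmetric M x ?w) (\<lambda>u. u \<in> feasible_vel M X x) v"
    using v by (auto simp: is_arg_max_def is_arg_min_def w feas)
  then have "rmetric M x ?w v \<ge> \<alpha> * rnorm M x ?w * (rnorm M x v)\<^sup>2"
    using RSI x tscale_tangent[OF gT] unfolding RSI_def by blast
  also have "rmetric M x ?w v = - rmetric M x (grad M f x) v"
    using v by (intro w feas) (simp add: is_arg_min_def)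
  also have "rnorm M x ?w = rnorm M x (grad M f x)"
    using w[OF gT] w[OF tscale_tangent[OF gT]] rmetric_sym[OF gT tscale_tangent[OF gT]]
    by (simp add: rnorm_def)
  finally have upper: "\<alpha> * rnorm M x (grad M f x) * (rnorm M x v)\<^sup>2 \<le> - rmetric M x (grad M f x) v" .
  have "min_grad_norm M X f \<le> rnorm M x (grad M f x)"
    unfolding min_grad_norm_def
  proof (rule cINF_lower[OF _ x])
    show "bdd_below ((\<lambda>x. rnorm M x (grad M f x)) ` X)"
      using rmetric_nonneg[OF grad_tangent[OF f]] by (auto simp: rnorm_def intro!: bdd_belowI[of _ 0])
  qed
  then have "\<alpha> * min_grad_norm M X f * (rnorm M x v)\<^sup>2 \<le> \<alpha> * rnorm M x (grad M f x) * (rnorm M x v)\<^sup>2"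
    using \<open>\<alpha> > 0\<close> by (intro mult_right_mono mult_left_mono) auto
  also note upper
  finally show ?thesis .
qed

end

text \<open>The open-loop step turns \<open>h \<le> g\<close> into a contraction by
  \<open>exp (- a / (k + a) + C / (k + a)\<^sup>2)\<close> with \<open>C = m a\<^sup>2 / 2\<close>. The factor
  \<open>exp (C / (k + a - 1))\<close> in the Lyapunov function absorbs the second term, because
  \<open>1 / (s - 1) - 1 / s \<ge> 1 / s\<^sup>2\<close>.\<close>

lemma open_loop_rate:
  fixes h g :: "nat \<Rightarrow> real"
  assumes a: "a \<ge> 2" and m: "m > 0" and K: "real K \<ge> a * m / 2 - a"
    and h: "\<And>k. 0 \<le> h k" "\<And>k. h k \<le> g k"
    and step: "\<And>k. h (Suc k) \<le> h k - a / (real k + a) * g k * (1 - m * (a / (real k + a)) / 2)"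
  shows "\<exists>B\<ge>0. \<forall>k\<ge>K. h k \<le> B * (real k + a) powr (- a)"
proof -
  define C where "C = m * a\<^sup>2 / 2"
  define W where "W k = h k * (real k + a) powr a * exp (C / (real k + a - 1))" for k
  have C0: "C \<ge> 0" using m by (simp add: C_def)
  have dec_step: "W (Suc k) \<le> W k" if k: "k \<ge> K" for k
  proof -
    let ?s = "real k + a"
    have s: "?s \<ge> 2" "?s > 0" using a by auto
    \<comment> \<open>The bound on \<open>K\<close> makes the last factor nonnegative, which allows
      replacing \<open>g k\<close> by the smaller \<open>h k\<close>.\<close>
    have "a * m / 2 \<le> ?s" using K k by linarith
    then have fac: "1 - m * (a / ?s) / 2 \<ge> 0" using s by (simp add: field_simps)
    have "h (Suc k) \<le> h k - a / ?s * g k * (1 - m * (a / ?s) / 2)" by (rule step)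
    also have "\<dots> \<le> h k - a / ?s * h k * (1 - m * (a / ?s) / 2)"
      using h(2)[of k] a s fac by (intro diff_left_mono mult_right_mono mult_left_mono) auto
    also have "\<dots> = h k * (1 + (- a / ?s + C / ?s\<^sup>2))"
      by (simp add: C_def algebra_simps power2_eq_square)
    also have "\<dots> \<le> h k * exp (- a / ?s + C / ?s\<^sup>2)"
      using h(1)[of k] by (intro mult_left_mono exp_ge_add_one_self)
    finally have 1: "h (Suc k) \<le> h k * exp (- a / ?s + C / ?s\<^sup>2)" .
    \<comment> \<open>The growth of the weight in one step is at most \<open>exp (a / ?s)\<close>,
      which cancels the main contraction factor exactly.\<close>
    have 2: "(?s + 1) powr a \<le> ?s powr a * exp (a / ?s)"
    proof -
      have "(?s + 1) powr a = (?s * (1 + 1 / ?s)) powr a" using s by (simp add: distrib_left)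
      also have "\<dots> = ?s powr a * (1 + 1 / ?s) powr a" by (rule powr_mult)
      also have "(1 + 1 / ?s) powr a \<le> exp (1 / ?s) powr a"
        using a s by (intro powr_mono2 exp_ge_add_one_self) auto
      also have "exp (1 / ?s) powr a = exp (a / ?s)" by (simp add: exp_powr_real)
      finally show ?thesis using s by (simp add: mult_left_mono)
    qed
    have 3: "C / ?s\<^sup>2 + C / ?s \<le> C / (?s - 1)"
    proof -
      have "1 / ?s\<^sup>2 + 1 / ?s \<le> 1 / (?s - 1)"
        using s by (simp add: divide_simps power2_eq_square) (simp add: algebra_simps)
      from mult_left_mono[OF this C0] show ?thesis by (simp add: algebra_simps)
    qed
    have "W (Suc k) = h (Suc k) * (?s + 1) powr a * exp (C / ?s)"
      by (simp add: W_def algebra_simps)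
    also have "\<dots> \<le> (h k * exp (- a / ?s + C / ?s\<^sup>2)) * (?s powr a * exp (a / ?s)) * exp (C / ?s)"
      using h(1)[of k] h(1)[of "Suc k"] by (intro mult_right_mono mult_mono 1 2) auto
    also have "\<dots> = h k * ?s powr a * (exp (- a / ?s + C / ?s\<^sup>2) * exp (a / ?s) * exp (C / ?s))"
      by (simp only: mult_ac)
    also have "exp (- a / ?s + C / ?s\<^sup>2) * exp (a / ?s) * exp (C / ?s) = exp (C / ?s\<^sup>2 + C / ?s)"
      by (simp only: exp_add[symmetric]) simp
    also have "h k * ?s powr a * exp (C / ?s\<^sup>2 + C / ?s) \<le> W k"
      unfolding W_def using h(1)[of k] 3 by (intro mult_left_mono) auto
    finally show ?thesis .
  qed
  have dec: "W k \<le> W K" if "k \<ge> K" for k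
    using that by (induction k rule: dec_induct) (auto intro: order_trans[OF dec_step])
  have "h k \<le> W K * (real k + a) powr (- a)" if k: "k \<ge> K" for k
  proof -
    have s: "real k + a > 1" using a by linarith
    \<comment> \<open>The correction factor is at least \<open>1\<close> because its exponent is
      nonnegative.\<close>
    have "h k * (real k + a) powr a * 1 \<le> W k" unfolding W_def
      using h(1)[of k] s C0 by (intro mult_left_mono) auto
    then have "h k * (real k + a) powr a \<le> W K" using dec[OF k] by simp
    then show ?thesis using s by (simp add: powr_minus field_simps)
  qed
  moreover have "W K \<ge> 0" using h(1)[of K] by (simp add: W_def)
  ultimately show ?thesis by blast
qed

section \<open>Best gap over the second half of the steps\<close>

text \<open>A discrete comparison with an integral: each new summand dominates the increment of the
  logarithm by \<open>ln (1 + t) \<le> t\<close>.\<close>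

lemma sum_step_sizes_ge:
  fixes a :: real
  assumes a: "a > 0" and le: "m \<le> k"
  shows "a * ln ((real k + a) / (real m + a)) \<le> (\<Sum>j=m..<k. a / (real j + a))"
  using le
proof (induction k rule: dec_induct)
  case base
  then show ?case using a by simp
next
  case (step k)
  have p: "real k + a > 0" "real m + a > 0" using a by auto
  have "ln ((real (Suc k) + a) / (real m + a))
      = ln ((real k + a) / (real m + a)) + ln (1 + 1 / (real k + a))"
  proof -
    have "real (Suc k) + a = (real k + a) * (1 + 1 / (real k + a))"
      using p by (simp add: distrib_left)
    then have eq: "(real (Suc k) + a) / (real m + a) = (real k + a) / (real m + a) * (1 + 1 / (real k + a))"
      by simp
    show ?thesis unfolding eq using p by (intro ln_mult_pos) (auto intro: add_pos_pos)
  qed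
  also have "ln (1 + 1 / (real k + a)) \<le> 1 / (real k + a)"
    using p by (intro ln_add_one_self_le_self) auto
  finally have "ln ((real (Suc k) + a) / (real m + a))
      \<le> ln ((real k + a) / (real m + a)) + 1 / (real k + a)" by simp
  from mult_left_mono[OF this, of a] have "a * ln ((real (Suc k) + a) / (real m + a))
      \<le> a * ln ((real k + a) / (real m + a)) + a / (real k + a)"
    using a by (simp add: distrib_left)
  then show ?case using step by simp
qed

text \<open>From index \<open>k div 2\<close> on, the last factor in \<open>step\<close> is at least
  \<open>1/2\<close>, so the weighted gaps are bounded by a telescoping sum, and the minimum is at
  most their weighted average.\<close>

lemma open_loop_best_gap:
  fixes h g :: "nat \<Rightarrow> real"
  assumes a: "a \<ge> 2" and m: "m > 0" and K: "real (k div 2) \<ge> a * m - a" and k: "real k \<ge> 2 * a"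
    and h: "\<And>k. 0 \<le> h k" "\<And>k. h k \<le> g k"
    and step: "\<And>k. h (Suc k) \<le> h k - a / (real k + a) * g k * (1 - m * (a / (real k + a)) / 2)"
  shows "Min (g ` {k div 2..<k}) \<le> 2 * h (k div 2) / (a * ln (3 / 2))"
proof -
  let ?n = "k div 2" let ?r = "Min (g ` {?n..<k})"
  have g0: "g j \<ge> 0" for j using h[of j] by linarith
  \<comment> \<open>This keeps the index range of the minimum nonempty.\<close>
  have k4: "k \<ge> 4" using k a by linarith
  then have nk: "?n < k" by simp
  have descent: "a / (real j + a) * g j \<le> 2 * (h j - h (Suc j))" if j: "j \<ge> ?n" for j
  proof -
    have s: "real j + a > 0" using a by auto
    have "a * m \<le> real j + a" using K j by linarith
    then have "1 - m * (a / (real j + a)) / 2 \<ge> 1 / 2" using s by (simp add: field_simps)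
    then have "a / (real j + a) * g j * (1 / 2) \<le> a / (real j + a) * g j * (1 - m * (a / (real j + a)) / 2)"
      using g0[of j] a by (intro mult_left_mono) auto
    also have "\<dots> \<le> h j - h (Suc j)" using step[of j] by (simp only: le_diff_eq diff_le_eq add.commute)
    finally have "a / (real j + a) * g j * (1 / 2) \<le> h j - h (Suc j)" .
    then show ?thesis unfolding times_divide_eq_right mult_1_right by (simp only: divide_le_eq_numeral1 mult.commute)
  qed
  have r: "?r \<le> g j" if "j \<in> {?n..<k}" for j using that by (intro Min_le) auto
  have r0: "?r \<ge> 0" using nk g0 by (subst Min_ge_iff) auto
  \<comment> \<open>After bounding \<open>?n\<close> by \<open>k / 2\<close> the claim is equivalent
    to \<open>k \<ge> 2 * a\<close>; this is the source of the constant \<open>3/2\<close>.\<close>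
  have ratio: "3 / 2 \<le> (real k + a) / (real ?n + a)"
  proof -
    have "real ?n \<le> real k / 2" by linarith
    then show ?thesis using k a by (simp add: field_simps)
  qed
  have "?r * (a * ln (3 / 2)) \<le> ?r * (a * ln ((real k + a) / (real ?n + a)))"
    using r0 a ratio by (intro mult_left_mono) auto
  also have "\<dots> \<le> ?r * (\<Sum>j=?n..<k. a / (real j + a))"
    using r0 a nk by (intro mult_left_mono sum_step_sizes_ge) auto
  also have "\<dots> = (\<Sum>j=?n..<k. a / (real j + a) * ?r)" by (simp add: sum_distrib_left mult.commute)
  also have "\<dots> \<le> (\<Sum>j=?n..<k. a / (real j + a) * g j)"
    using a r by (intro sum_mono mult_left_mono) auto
  also have "\<dots> \<le> (\<Sum>j=?n..<k. 2 * (h j - h (Suc j)))" by (intro sum_mono descent) auto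
  also have "\<dots> = 2 * (h ?n - h k)"
    using sum_Suc_diff'[of ?n k "\<lambda>j. - h j"] nk
    by (simp only: sum_distrib_left[symmetric]) simp
  also have "\<dots> \<le> 2 * h ?n" using h(1)[of k] by simp
  finally have "?r * (a * ln (3 / 2)) \<le> 2 * h ?n" .
  moreover have "a * ln (3 / 2) > 0" using a by simp
  ultimately show ?thesis by (simp add: pos_le_divide_eq)
qed

text \<open>The decay of \<open>h\<close> at index \<open>k div 2\<close> is inserted into the bound
  for the best gap.\<close>

lemma open_loop_best_gap_bigo:
  fixes h g :: "nat \<Rightarrow> real"
  assumes a: "a \<ge> 2" and m: "m > 0"
    and h: "\<And>k. 0 \<le> h k" "\<And>k. h k \<le> g k"
    and step: "\<And>k. h (Suc k) \<le> h k - a / (real k + a) * g k * (1 - m * (a / (real k + a)) / 2)"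
  shows "(\<lambda>k. Min (g ` {k div 2..<k})) \<in> O(\<lambda>k. real k powr (- a))"
proof -
  \<comment> \<open>Large enough for both thresholds, \<open>a * m / 2 - a\<close> for the rate and
    \<open>a * m - a\<close> for the best gap.\<close>
  define K where "K = nat \<lceil>a * m\<rceil>"
  have K: "real K \<ge> a * m" unfolding K_def by linarith
  have "a * m > 0" using a m by simp
  then have K2: "real K \<ge> a * m / 2 - a" "real K \<ge> a * m - a" using K a by linarith+
  obtain B where B: "B \<ge> 0" "\<And>k. k \<ge> K \<Longrightarrow> h k \<le> B * (real k + a) powr (- a)"
    using open_loop_rate[OF a m K2(1) h step] by blast
  \<comment> \<open>The factor \<open>(1/2) powr (-a)\<close> is the cost of evaluating the rate at
    half the index.\<close>
  let ?c = "2 * (B * (1/2) powr (-a)) / (a * ln (3 / 2))"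
  have "norm (Min (g ` {k div 2..<k})) \<le> ?c * norm (real k powr (- a))"
    if k: "k \<ge> max (2 * K) (nat \<lceil>2 * a\<rceil>)" for k
  proof -
    have n: "k div 2 \<ge> K" and ka: "real k \<ge> 2 * a" using k by linarith+
    have k4: "real k > 0" "k div 2 < k" using ka a by linarith+
    have "real (k div 2) \<ge> a * m - a" using K2 n by linarith
    then have "Min (g ` {k div 2..<k}) \<le> 2 * h (k div 2) / (a * ln (3 / 2))"
      by (rule open_loop_best_gap[OF a m _ ka h step])
    also have "\<dots> \<le> 2 * (B * (1/2 * real k) powr (- a)) / (a * ln (3 / 2))"
    proof -
      have "h (k div 2) \<le> B * (real (k div 2) + a) powr (- a)" by (rule B(2)[OF n])
      also have "\<dots> \<le> B * (1/2 * real k) powr (- a)"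
      proof (rule mult_left_mono[OF _ B(1)])
        \<comment> \<open>The shift by \<open>a\<close> absorbs the rounding of
          \<open>k div 2\<close>.\<close>
        have "1/2 * real k \<le> real (k div 2) + a" using a by linarith
        then show "(real (k div 2) + a) powr (- a) \<le> (1/2 * real k) powr (- a)"
          using a k4 by (intro powr_mono2') auto
      qed
      finally show ?thesis using a by (intro divide_right_mono) auto
    qed
    also have "\<dots> = ?c * real k powr (- a)" using k4 by (subst powr_mult) auto
    finally have "Min (g ` {k div 2..<k}) \<le> ?c * real k powr (- a)" .
    \<comment> \<open>Nonnegativity turns the upper bound into one for the norm.\<close>
    moreover have "Min (g ` {k div 2..<k}) \<ge> 0"
      using k4 order_trans[OF h] by (subst Min_ge_iff) auto
    ultimately show ?thesis by simp
  qed
  then show ?thesis by (intro bigoI[of _ ?c] eventually_sequentiallyI)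
qed

section \<open>Application to a run of the algorithm\<close>

theorem corollary5p4:
  fixes M :: "('m::{t2_space, second_countable_topology}, 'e::euclidean_space) riem"
    and X :: "'m set" and f :: "'m \<Rightarrow> real"
    and L \<alpha> a :: real
    and x :: "nat \<Rightarrow> 'm" and v :: "nat \<Rightarrow> ('m, 'e) tvec"
  assumes "riemannian_manifold M" and "connected (UNIV :: 'm set)" and "complete_manifold M"
    and "X \<noteq> {}" and "compact X" and "rdiameter M X > 0"
    and "weakly_min_geod_convex M X"
    and "\<exists>U. open U \<and> X \<subseteq> U \<and> (\<forall>y\<in>U. differentiable_at_pt M f y)"
    and "a \<ge> 2"
    and "L > 0" and "regularity M X f L"
    and "\<alpha> > 0" and "RSI M X \<alpha>"
    and "min_grad_norm M X f > 0"
    and "RFW_OL_run M X f a x v" and "\<not> RFW_OL_terminates M f x v"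
  shows "rec_gap M f x v \<in> O(\<lambda>k. real k powr (- a)) \<and>
    (\<forall>k. int (k div 2) \<ge> Khat_RSI a (M_RSI L \<alpha> (min_grad_norm M X f)) \<and> int k \<ge> \<lceil>2 * a\<rceil> \<longrightarrow>
       rec_gap M f x v k \<le> 2 * subopt f X (x (k div 2)) / (a * ln (3 / 2)))"
proof -
  interpret riemannian_mfd M by standard fact
  define \<nu> where "\<nu> = min_grad_norm M X f"
  define m where "m = M_RSI L \<alpha> \<nu>"
  define h where "h k = subopt f X (x k)" for k
  define g where "g = fw_gap M f x v"
  have \<nu>: "\<nu> > 0" using assms(14) by (simp add: \<nu>_def)
  have m: "m > 0" using \<open>L > 0\<close> \<open>\<alpha> > 0\<close> \<nu> by (simp add: m_def M_RSI_def)
  have diff: "differentiable_at_pt M f y" if "y \<in> X" for y using assms(8) that by blast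
  have "continuous_on X f"
    using differentiable_at_pt_continuous[OF diff] by (simp add: continuous_at_imp_continuous_on)
  then obtain y where y: "y \<in> X" "\<And>z. z \<in> X \<Longrightarrow> f y \<le> f z"
    using continuous_attains_inf[OF \<open>compact X\<close> \<open>X \<noteq> {}\<close>] by blast
  \<comment> \<open>Without termination the guards in \<open>RFW_OL_run\<close> hold at every index,
    so the update rule is available for all \<open>k\<close>.\<close>
  have nz: "fw_gap M f x v k \<noteq> 0" for k using assms(16) by (simp add: RFW_OL_terminates_def)
  have run: "is_arg_min (rmetric M (x k) (grad M f (x k))) (\<lambda>u. u \<in> feasible_vel M X (x k)) (v k)"
    "x (Suc k) = riem_exp M (x k) (tscale (a / (real k + a)) (v k))" for k
    using assms(15) nz unfolding RFW_OL_run_def by blast+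
  have feas: "v k \<in> feasible_vel M X (x k)" for k using run(1)[of k] by (simp add: is_arg_min_def)
  have eta: "a / (real k + a) \<in> {0..1}" for k using \<open>a \<ge> 2\<close> by (auto simp: field_simps)
  \<comment> \<open>Feasible velocities keep the whole segment in \<open>X\<close>, and the step
    sizes lie in \<open>{0..1}\<close>.\<close>
  have xX: "x k \<in> X" for k
  proof (induction k)
    case 0 then show ?case using assms(15) by (simp add: RFW_OL_run_def)
  next
    case (Suc k) then show ?case using feas[of k] eta[of k] unfolding run(2) feasible_vel_def by blast
  qed
  have INF: "(INF z\<in>X. f z) = f y" using y by (intro cInf_eq_minimum) auto
  have h0: "0 \<le> h k" for k using y(2)[OF xX] by (simp add: h_def subopt_def INF)
  have hg: "h k \<le> g k" for k unfolding h_def g_def fw_gap_def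
    by (rule subopt_le_fw_gap[OF assms(7,11) xX diff[OF xX] y])
      (use run(1)[of k] in \<open>auto simp: is_arg_min_linorder\<close>)
  have step: "h (Suc k) \<le> h k - a / (real k + a) * g k * (1 - m * (a / (real k + a)) / 2)" for k
  proof -
    let ?\<eta> = "a / (real k + a)" and ?N = "(rnorm M (x k) (v k))\<^sup>2"
    have "f (x (Suc k)) \<le> f (x k) + ?\<eta> * rmetric M (x k) (grad M f (x k)) (v k) + L / 2 * ?\<eta>\<^sup>2 * ?N"
      using assms(11) xX feas eta unfolding regularity_def run(2) by blast
    then have 1: "h (Suc k) \<le> h k - ?\<eta> * g k + L / 2 * ?\<eta>\<^sup>2 * ?N"
      by (simp add: h_def subopt_def g_def fw_gap_def)
    have "\<alpha> * \<nu> * ?N \<le> g k" unfolding \<nu>_def g_def fw_gap_def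
      by (rule RSI_norm_bound[OF assms(13,12) xX diff run(1)])
    then have "?N \<le> g k / (\<alpha> * \<nu>)" using \<open>\<alpha> > 0\<close> \<nu> by (simp add: field_simps)
    then have "L / 2 * ?\<eta>\<^sup>2 * ?N \<le> L / 2 * ?\<eta>\<^sup>2 * (g k / (\<alpha> * \<nu>))"
      using \<open>L > 0\<close> by (intro mult_left_mono) auto
    \<comment> \<open>The scaling inequality turns the quadratic smoothness error into a multiple of
      the gap, with \<open>m = L / (\<alpha> * \<nu>)\<close>.\<close>
    also have "L / 2 * \<eta>\<^sup>2 * (g k / (\<alpha> * \<nu>)) = \<eta> * g k * (m * \<eta> / 2)" for \<eta>
      by (simp add: m_def M_RSI_def power2_eq_square mult_ac)
    finally have "h (Suc k) \<le> h k - ?\<eta> * g k + ?\<eta> * g k * (m * ?\<eta> / 2)" using 1 by linarith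
    then show ?thesis by (simp only: right_diff_distrib mult_1_right)
  qed
  have rec: "rec_gap M f x v = (\<lambda>k. Min (g ` {k div 2..<k}))"
    by (simp add: fun_eq_iff rec_gap_def g_def)
  show ?thesis
  proof (intro conjI allI impI)
    show "rec_gap M f x v \<in> O(\<lambda>k. real k powr (- a))"
      unfolding rec by (rule open_loop_best_gap_bigo[OF \<open>a \<ge> 2\<close> m h0 hg step])
    fix k assume k: "int (k div 2) \<ge> Khat_RSI a (M_RSI L \<alpha> (min_grad_norm M X f)) \<and> int k \<ge> \<lceil>2 * a\<rceil>"
    \<comment> \<open>This entry of the maximum expresses that the step size times \<open>m\<close>
      is at most \<open>1\<close> from index \<open>k div 2\<close> on.\<close>
    then have "\<lceil>a * m - a\<rceil> \<le> int (k div 2)" by (simp add: Khat_RSI_def m_def \<nu>_def)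
    then have "a * m - a \<le> real (k div 2)" by (simp only: ceiling_le_iff of_int_of_nat_eq)
    moreover have "2 * a \<le> real k" using k by (simp only: ceiling_le_iff of_int_of_nat_eq)
    ultimately have "Min (g ` {k div 2..<k}) \<le> 2 * h (k div 2) / (a * ln (3 / 2))"
      by (intro open_loop_best_gap[OF \<open>a \<ge> 2\<close> m _ _ h0 hg step])
    then show "rec_gap M f x v k \<le> 2 * subopt f X (x (k div 2)) / (a * ln (3 / 2))"
      by (simp add: rec h_def)
  qed
qed

end
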